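(* Let $\mathbf{X}$ be a good sgrm and $\mathbf{W}$ an $N$-sgrm over $\mathbb{R}^d$ on $[0,T]$, and let $v=(v_1,\dots,v_d)$ with $v_i\in\mathcal{L}(\mathbb{R}^d)$. Then a path $Y:[0,T]\to\mathbb{R}^e$ solves $$dY=f(Y)\,d(T_v(\mathbf{X}))\qquad\text{resp.}\qquad dY=f(Y)\,d(\mathcal{T}_v[\mathbf{W}])$$ if and only if it solves $$dY=f^v(Y)\,d\mathbf{X}\qquad\text{resp.}\qquad dY=f^v(Y)\,d\mathbf{W}.$$
   Context: Fix $T>0$, $d,e\ge1$. $T((\mathbb{R}^d))$: formal tensor series over words in $\{1,\dots,d\}$ (incl. empty word, unit $\mathbf{1}$), concatenation $\otimes$, $\langle\mathbf{x},w\rangle$ coefficient of $w$; $T^N(\mathbb{R}^d)$: span of words of length $\le N$ with truncated product $\otimes_N$, projection $\mathrm{proj}_N$. Shuffle: bilinear, unit $\mathbf{1}$, $wi\sqcup\!\sqcup vj=(w\sqcup\!\sqcup vj)i+(wi\sqcup\!\sqcup v)j$. $\mathcal{L}(\mathbb{R}^d)$: Lie polynomials generated by the letters; $\mathcal{L}^N(\mathbb{R}^d)=\mathrm{proj}_N\mathcal{L}(\mathbb{R}^d)$. $N$-sgrm: non-zero $\mathbf{X}:[0,T]^2\to T^N(\mathbb{R}^d)$ with $\langle\mathbf{X}_{s,t},u\sqcup\!\sqcup w\rangle=\langle\mathbf{X}_{s,t},u\rangle\langle\mathbf{X}_{s,t},w\rangle$ ($|u|+|w|\le N$), $\mathbf{X}_{s,u}\otimes_N\mathbf{X}_{u,t}=\mathbf{X}_{s,t}$,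 smooth $t\mapsto\langle\mathbf{X}_{s,t},w\rangle$; sgrm: same in $T((\mathbb{R}^d))$ with $\otimes$ and all words. Diagonal derivative $\dot{\mathbf{X}}_{s,s}=\partial_t|_{t=s}\mathbf{X}_{s,t}$. $\mathrm{MinExt}(\mathbf{Y})$ of an $N$-sgrm $\mathbf{Y}$: the unique sgrm agreeing with $\mathbf{Y}$ on words of length $\le N$ with diagonal derivative in $\mathcal{L}^N(\mathbb{R}^d)$; good sgrm: $\mathrm{MinExt}(\mathbf{Y})$ for some $N$-sgrm $\mathbf{Y}$ (then its diagonal derivative lies in some $\mathcal{L}^K(\mathbb{R}^d)$ for all times). Translation: $T_v$ is the $\otimes$-algebra endomorphism of $T((\mathbb{R}^d))$ (continuous coordinatewise) with $e_i\mapsto e_i+v_i$; $T_v(\mathbf{X})_{s,t}:=T_v(\mathbf{X}_{s,t})$ (a good sgrm). With $N'$ the smallest integer such that $v_i\in\mathcal{L}^{N'}(\mathbb{R}^d)$ for all $i$ and $M=NN'$, $\mathcal{T}_v[\mathbf{W}]$ is the $M$-sgrm $\mathcal{T}_v[\mathbf{W}]_{s,t}:=\mathrm{proj}_MT_v(\mathrm{MinExt}(\mathbf{W})_{s,t})$. Vector fields: $f_1,\dots,f_d$ smooth on $\mathbb{R}^e$ with bounded derivatives; $g\vartriangleright h:=g^i(\partial_ih^j)\partial_j$; $f_{\mathbf{1}}=\mathrm{id}$, $f_{\ell_1\cdots\ell_n}:=f_{\ell_1}\vartriangleright(\cdots\vartriangleright(f_{\ell_{n-1}}\vartriangleright f_{\ell_n})\cdots)$,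 $f_{\mathbf{x}}:=\sum_w\langle\mathbf{x},w\rangle f_w$ for $\mathbf{x}\in T(\mathbb{R}^d)$. $f^v_i:=f_i+f_{v_i}$, and $f^v_w$ is built from $(f^v_1,\dots,f^v_d)$ by the same iterated $\vartriangleright$ formula. For $\mathbf{X}$ an $K$-sgrm or a good sgrm with $\dot{\mathbf{X}}_{s,s}\in\mathcal{L}^K(\mathbb{R}^d)$ for all $s$, and a family $g$ of this type, "$Y$ solves $dY=g(Y)d\mathbf{X}$" means $Y$ is smooth with $\dot Y_s=\sum_{|w|\le K}g_w(Y_s)\langle\dot{\mathbf{X}}_{s,s},w\rangle$ for all $s$.
   Formalization: N' is taken as the smallest integer at least 1 with all v_i in L^{N'}; for v = 0 the literal smallest integer is 0, giving M = 0, a trivial translated path, and a false equivalence. *)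

theory Defs
  imports "HOL-Analysis.Analysis"
begin

text \<open>A word over the alphabet {1..d} is a nat list with entries in {1..d}.
  A (formal) tensor series is represented by its coefficient function on words;
  coefficients of words not over the alphabet are required to be zero where relevant.\<close>

type_synonym word = "nat list"
type_synonym tensor = "word \<Rightarrow> real"

definition words :: "nat \<Rightarrow> nat \<Rightarrow> word set" where
  "words d n = {w. set w \<subseteq> {1..d} \<and> length w \<le> n}"

definition tunit :: tensor where
  "tunit = (\<lambda>w. if w = [] then 1 else 0)"

definition letter :: "nat \<Rightarrow> tensor" where
  "letter i = (\<lambda>w. if w = [i] then 1 else 0)"

definition tmul :: "tensor \<Rightarrow> tensor \<Rightarrow> tensor" where
  "tmul x y = (\<lambda>w. \<Sum>i\<le>length w. x (take i w) * y (drop i w))"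

definition proj :: "nat \<Rightarrow> tensor \<Rightarrow> tensor" where
  "proj N x = (\<lambda>w. if length w \<le> N then x w else 0)"

definition tmulN :: "nat \<Rightarrow> tensor \<Rightarrow> tensor \<Rightarrow> tensor" where
  "tmulN N x y = proj N (tmul x y)"

fun tprod_list :: "tensor list \<Rightarrow> tensor" where
  "tprod_list [] = tunit"
| "tprod_list (a # as) = tmul a (tprod_list as)"

text \<open>Shuffle on reversed words: first-letter recursion on reversed words is exactly the
  last-letter recursion wi sh vj = (w sh vj)i + (wi sh v)j. Result is a list (multiset) of words.\<close>
fun shr :: "word \<Rightarrow> word \<Rightarrow> word list" where
  "shr [] v = [v]"
| "shr u [] = [u]"
| "shr (i # w) (j # v) = map (\<lambda>x. i # x) (shr w (j # v)) @ map (\<lambda>x. j # x) (shr (i # w) v)"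

definition shuffle :: "word \<Rightarrow> word \<Rightarrow> word list" where
  "shuffle u v = map rev (shr (rev u) (rev v))"

definition pair_sh :: "tensor \<Rightarrow> word \<Rightarrow> word \<Rightarrow> real" where
  "pair_sh x u w = sum_list (map x (shuffle u w))"

definition bracket :: "tensor \<Rightarrow> tensor \<Rightarrow> tensor" where
  "bracket a b = (\<lambda>w. tmul a b w - tmul b a w)"

inductive lie :: "nat \<Rightarrow> tensor \<Rightarrow> bool" for d where
  lie_letter: "i \<in> {1..d} \<Longrightarrow> lie d (letter i)"
| lie_add: "lie d a \<Longrightarrow> lie d b \<Longrightarrow> lie d (\<lambda>w. a w + b w)"
| lie_scale: "lie d a \<Longrightarrow> lie d (\<lambda>w. c * a w)"
| lie_bracket: "lie d a \<Longrightarrow> lie d b \<Longrightarrow> lie d (bracket a b)"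

definition in_LN :: "nat \<Rightarrow> nat \<Rightarrow> tensor \<Rightarrow> bool" where
  "in_LN d N x \<longleftrightarrow> (\<exists>l. lie d l \<and> x = proj N l)"

definition smooth_on :: "real set \<Rightarrow> (real \<Rightarrow> 'a::real_normed_vector) \<Rightarrow> bool" where
  "smooth_on S f \<longleftrightarrow> (\<exists>D. D 0 = f \<and>
     (\<forall>k. \<forall>x\<in>S. (D k has_vector_derivative D (Suc k) x) (at x within S)))"

definition nsgrm :: "real \<Rightarrow> nat \<Rightarrow> nat \<Rightarrow> (real \<Rightarrow> real \<Rightarrow> tensor) \<Rightarrow> bool" where
  "nsgrm T d N X \<longleftrightarrow>
     (\<exists>s\<in>{0..T}. \<exists>t\<in>{0..T}. X s t \<noteq> (\<lambda>w. 0)) \<and>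
     (\<forall>s\<in>{0..T}. \<forall>t\<in>{0..T}. \<forall>w. w \<notin> words d N \<longrightarrow> X s t w = 0) \<and>
     (\<forall>s\<in>{0..T}. \<forall>t\<in>{0..T}. \<forall>u w. set u \<subseteq> {1..d} \<longrightarrow> set w \<subseteq> {1..d} \<longrightarrow>
        length u + length w \<le> N \<longrightarrow> pair_sh (X s t) u w = X s t u * X s t w) \<and>
     (\<forall>s\<in>{0..T}. \<forall>u\<in>{0..T}. \<forall>t\<in>{0..T}. tmulN N (X s u) (X u t) = X s t) \<and>
     (\<forall>s\<in>{0..T}. \<forall>w. smooth_on {0..T} (\<lambda>t. X s t w))"

definition sgrm :: "real \<Rightarrow> nat \<Rightarrow> (real \<Rightarrow> real \<Rightarrow> tensor) \<Rightarrow> bool" where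
  "sgrm T d X \<longleftrightarrow>
     (\<exists>s\<in>{0..T}. \<exists>t\<in>{0..T}. X s t \<noteq> (\<lambda>w. 0)) \<and>
     (\<forall>s\<in>{0..T}. \<forall>t\<in>{0..T}. \<forall>w. \<not> set w \<subseteq> {1..d} \<longrightarrow> X s t w = 0) \<and>
     (\<forall>s\<in>{0..T}. \<forall>t\<in>{0..T}. \<forall>u w. set u \<subseteq> {1..d} \<longrightarrow> set w \<subseteq> {1..d} \<longrightarrow>
        pair_sh (X s t) u w = X s t u * X s t w) \<and>
     (\<forall>s\<in>{0..T}. \<forall>u\<in>{0..T}. \<forall>t\<in>{0..T}. tmul (X s u) (X u t) = X s t) \<and>
     (\<forall>s\<in>{0..T}. \<forall>w. smooth_on {0..T} (\<lambda>t. X s t w))"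

definition diag :: "real \<Rightarrow> (real \<Rightarrow> real \<Rightarrow> tensor) \<Rightarrow> real \<Rightarrow> tensor" where
  "diag T X s = (\<lambda>w. vector_derivative (\<lambda>t. X s t w) (at s within {0..T}))"

definition minext_of :: "real \<Rightarrow> nat \<Rightarrow> nat \<Rightarrow> (real \<Rightarrow> real \<Rightarrow> tensor) \<Rightarrow> (real \<Rightarrow> real \<Rightarrow> tensor) \<Rightarrow> bool" where
  "minext_of T d N Y X \<longleftrightarrow> sgrm T d X \<and>
     (\<forall>s\<in>{0..T}. \<forall>t\<in>{0..T}. \<forall>w. length w \<le> N \<longrightarrow> X s t w = Y s t w) \<and>
     (\<forall>s\<in>{0..T}. in_LN d N (diag T X s))"

text \<open>MinExt: the unique such sgrm (normalised to 0 outside [0,T]^2 so that it is unique as a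
  HOL function).\<close>
definition MinExt :: "real \<Rightarrow> nat \<Rightarrow> nat \<Rightarrow> (real \<Rightarrow> real \<Rightarrow> tensor) \<Rightarrow> (real \<Rightarrow> real \<Rightarrow> tensor)" where
  "MinExt T d N Y = (THE X. minext_of T d N Y X \<and>
     (\<forall>s t. \<not> (s \<in> {0..T} \<and> t \<in> {0..T}) \<longrightarrow> X s t = (\<lambda>w. 0)))"

definition good_sgrm :: "real \<Rightarrow> nat \<Rightarrow> (real \<Rightarrow> real \<Rightarrow> tensor) \<Rightarrow> bool" where
  "good_sgrm T d X \<longleftrightarrow> (\<exists>N Y. nsgrm T d N Y \<and> minext_of T d N Y X)"

text \<open>T_v is the continuous algebra endomorphism with e_i \<mapsto> e_i + v_i. Since Lie polynomials
  have no constant term, the coefficient of u in T_v(x) only involves words of length \<le> |u|.\<close>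
definition tv :: "nat \<Rightarrow> (nat \<Rightarrow> tensor) \<Rightarrow> tensor \<Rightarrow> tensor" where
  "tv d v x = (\<lambda>u. \<Sum>w\<in>words d (length u).
      x w * tprod_list (map (\<lambda>i. \<lambda>z. letter i z + v i z) w) u)"

definition Tv_path :: "nat \<Rightarrow> (nat \<Rightarrow> tensor) \<Rightarrow> (real \<Rightarrow> real \<Rightarrow> tensor) \<Rightarrow> (real \<Rightarrow> real \<Rightarrow> tensor)" where
  "Tv_path d v X = (\<lambda>s t. tv d v (X s t))"

definition Nprime :: "nat \<Rightarrow> (nat \<Rightarrow> tensor) \<Rightarrow> nat" where
  "Nprime d v = (LEAST n. 1 \<le> n \<and> (\<forall>i\<in>{1..d}. in_LN d n (v i)))"

definition calT :: "real \<Rightarrow> nat \<Rightarrow> nat \<Rightarrow> (nat \<Rightarrow> tensor) \<Rightarrow> (real \<Rightarrow> real \<Rightarrow> tensor) \<Rightarrow> (real \<Rightarrow> real \<Rightarrow> tensor)" where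
  "calT T d N v W = (\<lambda>s t. proj (N * Nprime d v) (tv d v (MinExt T d N W s t)))"

text \<open>Smooth with bounded derivatives: P bs is the iterated partial derivative along the basis
  directions in bs; all derivatives of order \<ge> 1 are bounded.\<close>
definition vf_smooth_bdd :: "('a::euclidean_space \<Rightarrow> 'a) \<Rightarrow> bool" where
  "vf_smooth_bdd f \<longleftrightarrow> (\<exists>P :: 'a list \<Rightarrow> 'a \<Rightarrow> 'a. P [] = f \<and>
     (\<forall>bs y. set bs \<subseteq> Basis \<longrightarrow>
        (P bs has_derivative (\<lambda>h. \<Sum>b\<in>Basis. (h \<bullet> b) *\<^sub>R P (b # bs) y)) (at y)) \<and>
     (\<forall>bs. set bs \<subseteq> Basis \<longrightarrow> bs \<noteq> [] \<longrightarrow> bounded (range (P bs))))"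

definition tri :: "('a::real_normed_vector \<Rightarrow> 'a) \<Rightarrow> ('a \<Rightarrow> 'a) \<Rightarrow> 'a \<Rightarrow> 'a" where
  "tri g h = (\<lambda>y. frechet_derivative h (at y) (g y))"

fun vf_word :: "(nat \<Rightarrow> 'a::real_normed_vector \<Rightarrow> 'a) \<Rightarrow> word \<Rightarrow> 'a \<Rightarrow> 'a" where
  "vf_word F [] = id"
| "vf_word F [l] = F l"
| "vf_word F (l # m # w) = tri (F l) (vf_word F (m # w))"

definition vf_tensor :: "(nat \<Rightarrow> 'a::real_normed_vector \<Rightarrow> 'a) \<Rightarrow> tensor \<Rightarrow> 'a \<Rightarrow> 'a" where
  "vf_tensor F x = (\<lambda>y. \<Sum>w\<in>{w. x w \<noteq> 0}. x w *\<^sub>R vf_word F w y)"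

definition Fv :: "(nat \<Rightarrow> 'a::real_normed_vector \<Rightarrow> 'a) \<Rightarrow> (nat \<Rightarrow> tensor) \<Rightarrow> nat \<Rightarrow> 'a \<Rightarrow> 'a" where
  "Fv F v i = (\<lambda>y. F i y + vf_tensor F (v i) y)"

definition solves :: "real \<Rightarrow> nat \<Rightarrow> (nat \<Rightarrow> 'a::real_normed_vector \<Rightarrow> 'a) \<Rightarrow> nat \<Rightarrow>
    (real \<Rightarrow> real \<Rightarrow> tensor) \<Rightarrow> (real \<Rightarrow> 'a) \<Rightarrow> bool" where
  "solves T d G K X Y \<longleftrightarrow> smooth_on {0..T} Y \<and>
     (\<forall>s\<in>{0..T}. (Y has_vector_derivative
        (\<Sum>w\<in>words d K. diag T X s w *\<^sub>R vf_word G w (Y s))) (at s within {0..T}))"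

definition solves_good :: "real \<Rightarrow> nat \<Rightarrow> (nat \<Rightarrow> 'a::real_normed_vector \<Rightarrow> 'a) \<Rightarrow>
    (real \<Rightarrow> real \<Rightarrow> tensor) \<Rightarrow> (real \<Rightarrow> 'a) \<Rightarrow> bool" where
  "solves_good T d G X Y \<longleftrightarrow> (\<exists>K. (\<forall>s\<in>{0..T}. in_LN d K (diag T X s)) \<and> solves T d G K X Y)"

end

theory Submission
  imports Defs
begin

text \<open>
  A vector field acts on functions as a first-order differential operator, and \<open>f\<^sub>w\<close> is the
  corresponding composition of operators applied to the identity. The operator of a Lie polynomial
  is again first order, namely the derivation along \<open>f\<^sub>x\<close>, because second derivatives are
  symmetric. Hence \<open>f\<^sup>v\<^sub>w\<close> is the field of \<open>T\<^sub>v w\<close>, and as taking the diagonal derivative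
  commutes with \<open>T\<^sub>v\<close>, both equations have the same right-hand side.

  For an \<open>N\<close>-sgrm, one also has to know that the minimal extension exists and is unique.
  Differentiating the shuffle relation shows that the diagonal derivative is primitive, hence Lie
  by the Dynkin-Specht-Wever theorem. It is smooth in time, so iterated integrals solve
  \<open>\<partial>\<^sub>t Z = Z \<otimes> x\<^sub>t\<close>; every semigroup of tensors solves this equation for its own diagonal derivative,
  and solutions are unique by induction on the word length.
\<close>

section \<open>Tensors and shuffles\<close>

text \<open>The product \<open>tri\<close> is not associative: \<open>tri f (tri g h)\<close> and
  \<open>tri (tri f g) h\<close> differ by the second derivative of \<open>h\<close> in the
  directions \<open>f\<close> and \<open>g\<close>. Fields are therefore studied through their
  action on an arbitrary smooth \<open>h\<close>. In \<open>T_v w\<close> only the single factor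
  \<open>e_i + v_i\<close> acting at each step has to be Lie; the product of the others need not be.

  \<open>calT\<close> rests on a definite description, so nothing is known about it before existence
  and uniqueness are proved. The shuffle relation of \<open>W\<close> stops at level
  \<open>N\<close>, but its diagonal derivative vanishes above \<open>N\<close>; hence it is
  primitive without restriction and drives a full sgrm whose derivative stays at level
  \<open>N\<close>.

  For good \<open>X\<close> the level \<open>K\<close> is existential and may differ between the two
  equations, so their sums are compared through the support of the derivative. The level
  \<open>N * N'\<close> appears because \<open>T_v\<close> turns a word of length \<open>n\<close>
  into words of length between \<open>n\<close> and \<open>n * N'\<close>.\<close>

lemma sum_splits_Cons:
  "(\<Sum>k\<le>length (i # w). g (take k (i # w)) (drop k (i # w)))
    = g [] (i # w) + (\<Sum>k\<le>length w. g (i # take k w) (drop k w))"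
  by (simp only: list.size add_Suc_right add_0_right sum.atMost_Suc_shift) simp

lemma tmul_Nil [simp]: "tmul a b [] = a [] * b []"
  by (simp add: tmul_def)

lemma tmul_Cons: "tmul a b (i # w) = a [] * b (i # w) + tmul (\<lambda>z. a (i # z)) b w"
  using sum_splits_Cons[of "\<lambda>p q. a p * b q"] by (simp add: tmul_def)

lemma tmul_snoc: "tmul a b (w @ [i]) = tmul a (\<lambda>z. b (z @ [i])) w + a (w @ [i]) * b []"
  by (induction w arbitrary: a) (simp_all add: tmul_Cons)

lemma tmul_zero_left [simp]: "tmul (\<lambda>z. 0) b = (\<lambda>w. 0)"
  and tmul_zero_right [simp]: "tmul a (\<lambda>z. 0) = (\<lambda>w. 0)"
  by (auto simp: tmul_def)

lemma tmul_tunit_left [simp]: "tmul tunit b = b"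
proof
  fix w show "tmul tunit b w = b w"
    by (cases w) (simp_all add: tmul_Cons tunit_def)
qed

lemma tmul_tunit_right [simp]: "tmul a tunit = a"
proof
  fix w show "tmul a tunit w = a w"
    by (cases w rule: rev_cases) (simp_all add: tmul_snoc tunit_def)
qed

lemma tmul_add_left: "tmul (\<lambda>z. a z + a' z) b = (\<lambda>w. tmul a b w + tmul a' b w)"
  and tmul_scale_left: "tmul (\<lambda>z. c * a z) b = (\<lambda>w. c * tmul a b w)"
  by (auto simp: tmul_def sum.distrib sum_distrib_left algebra_simps)

lemma tmul_assoc: "tmul (tmul a b) c = tmul a (tmul b c)"
proof
  fix w show "tmul (tmul a b) c w = tmul a (tmul b c) w"
  proof (induction w arbitrary: a)
    case (Cons i w)
    have "(\<lambda>z. tmul a b (i # z)) = (\<lambda>z. a [] * b (i # z) + tmul (\<lambda>z. a (i # z)) b z)"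
      by (simp add: tmul_Cons)
    then show ?case
      by (simp add: tmul_Cons tmul_add_left tmul_scale_left Cons algebra_simps)
  qed simp
qed

text \<open>The underlying recursion \<open>shr\<close> removes first letters, which suits induction
  on lists, while \<open>pair_sh\<close> removes last letters; \<open>pair_sh_eq_shp\<close> shows
  that the choice of end is immaterial.\<close>

definition shp :: "tensor \<Rightarrow> word \<Rightarrow> word \<Rightarrow> real" where
  "shp x u v = sum_list (map x (shr u v))"

lemma shp_Nil_left [simp]: "shp x [] v = x v"
  and shp_Nil_right [simp]: "shp x u [] = x u"
  by (simp_all add: shp_def) (cases u; simp)

lemma shp_Cons:
  "shp x (i # u) (j # v) = shp (\<lambda>z. x (i # z)) u (j # v) + shp (\<lambda>z. x (j # z)) (i # u) v"
  by (simp add: shp_def comp_def)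

lemma shp_add: "shp (\<lambda>z. x z + y z) u v = shp x u v + shp y u v"
  by (simp add: shp_def sum_list_addf)

lemma shp_scale: "shp (\<lambda>z. c * x z) u v = c * shp x u v"
  by (simp add: shp_def sum_list_const_mult)

lemma set_length_shr:
  "z \<in> set (shr u v) \<Longrightarrow> set z = set u \<union> set v \<and> length z = length u + length v"
  by (induction u v arbitrary: z rule: shr.induct) auto

lemma shp_eq_0:
  assumes "\<And>z. set z = set u \<union> set v \<Longrightarrow> length z = length u + length v \<Longrightarrow> x z = 0"
  shows "shp x u v = 0"
proof -
  have "map x (shr u v) = map (\<lambda>_. 0) (shr u v)"
    using assms set_length_shr by (intro map_cong) auto
  then show ?thesis unfolding shp_def by (simp only: sum_list_0)
qed

text \<open>An interleaving ends in \<open>i\<close> or in \<open>j\<close>, so a shuffle built from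
  the front also recurses from the back. Invariance under reversal and the Dynkin recursion rest on
  this.\<close>

lemma shp_snoc:
  "shp x (u @ [i]) (v @ [j]) = shp (\<lambda>z. x (z @ [i])) u (v @ [j]) + shp (\<lambda>z. x (z @ [j])) (u @ [i]) v"
proof (induction u v arbitrary: x rule: shr.induct)
  case (1 v)
  show ?case
  proof (induction v arbitrary: x)
    case (Cons k v)
    show ?case using Cons[of "\<lambda>z. x (k # z)"] by (simp add: shp_Cons)
  qed (simp add: shp_Cons)
next
  case (2 k u)
  show ?case
  proof (induction u arbitrary: x k)
    case Nil
    show ?case by (simp add: shp_Cons)
  next
    case (Cons l u)
    show ?case using Cons[of "\<lambda>z. x (k # z)" l] by (simp add: shp_Cons)
  qed
next
  case (3 k u l v)
  show ?case
    using 3(1)[of "\<lambda>z. x (k # z)"] 3(2)[of "\<lambda>z. x (l # z)"] by (simp add: shp_Cons)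
qed

lemma shp_rev: "shp (\<lambda>z. x (rev z)) u v = shp x (rev u) (rev v)"
proof (induction u v arbitrary: x rule: shr.induct)
  case (3 i u j v)
  show ?case
    using 3(1)[of "\<lambda>z. x (z @ [i])"] 3(2)[of "\<lambda>z. x (z @ [j])"]
    by (simp add: shp_Cons shp_snoc)
qed simp_all

lemma pair_sh_eq_shp: "pair_sh x u v = shp x u v"
proof -
  have "pair_sh x u v = shp (\<lambda>z. x (rev z)) (rev u) (rev v)"
    by (simp add: pair_sh_def shuffle_def shp_def comp_def)
  then show ?thesis by (simp add: shp_rev)
qed

text \<open>Cutting an interleaving of \<open>u\<close> and \<open>v\<close> cuts each of the two
  words, and conversely: deconcatenation is a morphism for the shuffle product.\<close>

lemma shp_tmul:
  "shp (tmul a b) u v = (\<Sum>p\<le>length u. \<Sum>q\<le>length v.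
      shp a (take p u) (take q v) * shp b (drop p u) (drop q v))"
proof (induction u v arbitrary: a rule: shr.induct)
  case (1 v)
  show ?case by (simp add: tmul_def)
next
  case (2 i u)
  show ?case by (simp add: tmul_def)
next
  case (3 i u j v)
  have A: "shp (\<lambda>z. tmul a b (i # z)) u (j # v)
      = a [] * shp (\<lambda>z. b (i # z)) u (j # v) + shp (tmul (\<lambda>z. a (i # z)) b) u (j # v)"
    by (simp add: tmul_Cons shp_add shp_scale)
  have B: "shp (\<lambda>z. tmul a b (j # z)) (i # u) v
      = a [] * shp (\<lambda>z. b (j # z)) (i # u) v + shp (tmul (\<lambda>z. a (j # z)) b) (i # u) v"
    by (simp add: tmul_Cons shp_add shp_scale)
  define G where "G a' p p' = (\<Sum>q\<le>length (j # v).
      shp a' p (take q (j # v)) * shp b p' (drop q (j # v)))" for a' p p'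
  have G: "G a' p p' = a' p * shp b p' (j # v)
      + (\<Sum>q\<le>length v. shp a' p (j # take q v) * shp b p' (drop q v))" for a' p p'
    unfolding G_def using sum_splits_Cons[of "\<lambda>q q'. shp a' p q * shp b p' q'" j v] by simp
  define H where "H p p' = (\<Sum>q\<le>length v.
      shp (\<lambda>z. a (j # z)) p (take q v) * shp b p' (drop q v))" for p p'
  have "shp (tmul (\<lambda>z. a (i # z)) b) u (j # v) = (\<Sum>p\<le>length u. G (\<lambda>z. a (i # z)) (take p u) (drop p u))"
    using 3(1) by (simp add: G_def)
  moreover have "shp (tmul (\<lambda>z. a (j # z)) b) (i # u) v
      = H [] (i # u) + (\<Sum>p\<le>length u. H (i # take p u) (drop p u))"
    using 3(2) sum_splits_Cons[of H i u] by (simp add: H_def)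
  moreover have "(\<Sum>p\<le>length (i # u). G a (take p (i # u)) (drop p (i # u)))
      = G a [] (i # u) + (\<Sum>p\<le>length u. G a (i # take p u) (drop p u))"
    by (rule sum_splits_Cons)
  ultimately show ?case
    unfolding shp_Cons[of "tmul a b"] A B G_def[symmetric]
    by (simp add: G H_def shp_Cons[of b] shp_Cons[of a] sum.distrib algebra_simps)
qed

section \<open>Primitive elements are Lie\<close>

text \<open>Primitive for the coproduct dual to the shuffle product: the infinitesimal form, at the
  unit, of being a shuffle character.\<close>

definition primitive :: "tensor \<Rightarrow> bool" where
  "primitive x \<longleftrightarrow> x [] = 0 \<and> (\<forall>u v. u \<noteq> [] \<longrightarrow> v \<noteq> [] \<longrightarrow> shp x u v = 0)"

text \<open>The word is read from its last letter: \<open>lnest\<close> of the reversal of \<open>w\<close> is the left-nested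
  bracket \<open>[\<dots>[[w1, w2], w3]\<dots>, wn]\<close>.\<close>

fun lnest :: "word \<Rightarrow> tensor" where
  "lnest [] = (\<lambda>w. 0)"
| "lnest [i] = letter i"
| "lnest (i # j # w) = bracket (lnest (j # w)) (letter i)"

definition lwords :: "nat \<Rightarrow> nat \<Rightarrow> word set" where
  "lwords d n = {w. set w \<subseteq> {1..d} \<and> length w = n}"

lemma finite_lwords [simp]: "finite (lwords d n)"
  unfolding lwords_def by (rule finite_lists_length_eq) simp

lemma sum_lwords_Suc:
  "(\<Sum>w\<in>lwords d (Suc n). g w) = (\<Sum>i\<in>{1..d}. \<Sum>w\<in>lwords d n. g (i # w))"
proof -
  have "bij_betw (\<lambda>(i, w). i # w) ({1..d} \<times> lwords d n) (lwords d (Suc n))"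
    by (rule bij_betwI[of _ _ _ "\<lambda>w. (hd w, tl w)"])
      (auto simp: lwords_def length_Suc_conv)
  then show ?thesis
    by (subst sum.cartesian_product) (simp add: sum.reindex_bij_betw[symmetric] case_prod_unfold)
qed

lemma letter_Nil [simp]: "letter i [] = 0"
  by (simp add: letter_def)

lemma letter_Cons: "(\<lambda>z. letter i (h # z)) = (if h = i then tunit else (\<lambda>z. 0))"
  and letter_snoc: "(\<lambda>z. letter i (z @ [h])) = (if h = i then tunit else (\<lambda>z. 0))"
  by (auto simp: letter_def tunit_def fun_eq_iff)

lemma bracket_letter:
  assumes "u \<noteq> []"
  shows "bracket a (letter i) u
    = (if last u = i then a (butlast u) else 0) - (if hd u = i then a (tl u) else 0)"
proof -
  have "tmul a (letter i) u = (if last u = i then a (butlast u) else 0)"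
  proof -
    obtain p k where u: "u = p @ [k]" using assms by (cases u rule: rev_cases) auto
    show ?thesis unfolding u tmul_snoc letter_snoc by (simp add: letter_def)
  qed
  moreover have "tmul (letter i) a u = (if hd u = i then a (tl u) else 0)"
    using assms by (cases u) (simp_all add: tmul_Cons letter_Cons letter_Nil)
  ultimately show ?thesis by (simp add: bracket_def)
qed

text \<open>The adjoint of the Dynkin operator. In the shuffle algebra it equals the alternating sum over
  \<open>k\<close> of \<open>(n - k)\<close> times the shuffle of \<open>rev (take k u)\<close> with \<open>drop k u\<close>, so a primitive
  element only sees the term \<open>k = 0\<close>.\<close>

definition dynkin_adj :: "tensor \<Rightarrow> word \<Rightarrow> real" where
  "dynkin_adj x u = (\<Sum>j<length u. (- 1) ^ j *
      shp (\<lambda>z. x (u ! j # z)) (rev (take j u)) (drop (Suc j) u))"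

text \<open>The reversed prefix ends in \<open>hd u\<close> and the suffix in \<open>last u\<close>,
  so the last-letter recursion splits each summand in two. The part that loses \<open>hd u\<close>
  shifts \<open>j\<close> by one and so changes sign, matching the minus sign in
  \<open>bracket_letter\<close>.\<close>

lemma dynkin_adj_rec:
  assumes "length u = Suc (Suc n)"
  shows "dynkin_adj x u
    = dynkin_adj (\<lambda>z. x (z @ [last u])) (butlast u) - dynkin_adj (\<lambda>z. x (z @ [hd u])) (tl u)"
proof -
  define E where "E j = (- 1) ^ j * shp (\<lambda>z. x (butlast u ! j # z @ [last u]))
      (rev (take j (butlast u))) (drop (Suc j) (butlast u))" for j
  define H where "H j = (- 1) ^ j * shp (\<lambda>z. x (tl u ! j # z @ [hd u]))
      (rev (take j (tl u))) (drop (Suc j) (tl u))" for j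
  \<comment> \<open>At \<open>j = 0\<close> the prefix is empty and at \<open>j = Suc n\<close> the
    suffix is, so each end contributes only one part.\<close>
  have eq: "(- 1) ^ j * shp (\<lambda>z. x (u ! j # z)) (rev (take j u)) (drop (Suc j) u)
      = (if j < Suc n then E j else 0) - (if j = 0 then 0 else H (j - 1))"
    if "j < Suc (Suc n)" for j
  proof -
    obtain h t where u: "u = h # t" using assms by (cases u) auto
    have t: "length t = Suc n" using assms u by simp
    obtain p l where tp: "t = p @ [l]" using t by (cases t rule: rev_cases) auto
    have p: "length p = n" using t tp by simp
    show ?thesis
    proof (cases j)
      case 0
      then show ?thesis using p by (cases p) (simp_all add: E_def u tp)
    next
      case (Suc m)
      have rt: "rev (take j u) = rev (take m t) @ [h]" by (simp add: Suc u)
      have dt: "drop (Suc j) u = drop j t" by (simp add: u)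
      have bl: "butlast u = h # p" "last u = l" "hd u = h" "tl u = t" by (auto simp: u tp)
      show ?thesis
      proof (cases "j = Suc n")
        case True
        then show ?thesis using t Suc by (simp add: H_def rt bl u)
      next
        case False
        with that have jn: "j \<le> n" by simp
        have d: "drop j t = drop j p @ [l]" using jn p by (simp add: tp)
        have ph: "p ! m = t ! m" "take m p = take m t" using jn p Suc by (simp_all add: tp nth_append)
        have "shp (\<lambda>z. x (u ! j # z)) (rev (take j u)) (drop (Suc j) u)
          = shp (\<lambda>z. x (u ! j # z @ [h])) (rev (take m t)) (drop j t)
            + shp (\<lambda>z. x (u ! j # z @ [l])) (rev (take m t) @ [h]) (drop j p)"
          unfolding rt dt d by (subst shp_snoc) simp
        then show ?thesis using jn p Suc ph
          unfolding E_def H_def bl by (simp add: u algebra_simps)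
      qed
    qed
  qed
  have "dynkin_adj x u = (\<Sum>j<Suc (Suc n). (if j < Suc n then E j else 0) - (if j = 0 then 0 else H (j - 1)))"
    unfolding dynkin_adj_def assms by (rule sum.cong) (use eq in auto)
  also have "\<dots> = (\<Sum>j<Suc (Suc n). (if j < Suc n then E j else 0))
      - (\<Sum>j<Suc (Suc n). if j = 0 then 0 else H (j - 1))"
    by (rule sum_subtractf)
  also have "(\<Sum>j<Suc (Suc n). (if j < Suc n then E j else 0)) = (\<Sum>j<Suc n. E j)"
    by (subst sum.lessThan_Suc) simp
  also have "(\<Sum>j<Suc (Suc n). if j = 0 then 0 else H (j - 1)) = (\<Sum>j<Suc n. H j)"
    by (subst sum.lessThan_Suc_shift) simp
  finally show ?thesis by (simp add: dynkin_adj_def E_def H_def assms)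
qed

text \<open>Peeling the outermost bracket of \<open>lnest w\<close> with
  \<open>bracket_letter\<close> reproduces \<open>dynkin_adj_rec\<close>. As \<open>u\<close> lies
  over the alphabet, its first and last letters both occur in the sum over \<open>i\<close>.\<close>

lemma sum_lnest_eq_dynkin_adj:
  assumes "set u \<subseteq> {1..d}" "length u = Suc n"
  shows "(\<Sum>w\<in>lwords d (Suc n). x (rev w) * lnest w u) = dynkin_adj x u"
  using assms
proof (induction n arbitrary: x u)
  case 0
  then obtain i where i: "u = [i]" "i \<in> {1..d}" by (auto simp: length_Suc_conv)
  have "lwords d 0 = {[]}" by (auto simp: lwords_def)
  then show ?case using i
    by (simp add: sum_lwords_Suc dynkin_adj_def letter_def eq_commute[of i] if_distrib[of "\<lambda>c. _ * c"] cong: if_cong)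
next
  case (Suc n)
  have ne: "u \<noteq> []" using Suc.prems by auto
  have hl: "hd u \<in> {1..d}" "last u \<in> {1..d}" using ne Suc.prems(1) by (auto simp del: atLeastAtMost_iff)
  have l: "lnest (i # w) u = (if last u = i then lnest w (butlast u) else 0)
      - (if hd u = i then lnest w (tl u) else 0)" if "w \<in> lwords d (Suc n)" for i w
    using that bracket_letter[OF ne, of "lnest w" i] by (cases w) (auto simp: lwords_def)
  have "(\<Sum>w\<in>lwords d (Suc (Suc n)). x (rev w) * lnest w u)
    = (\<Sum>i\<in>{1..d}. \<Sum>w\<in>lwords d (Suc n). x (rev w @ [i]) *
        ((if last u = i then lnest w (butlast u) else 0) - (if hd u = i then lnest w (tl u) else 0)))"
    by (subst sum_lwords_Suc) (simp add: l)
  also have "\<dots> = (\<Sum>w\<in>lwords d (Suc n). \<Sum>i\<in>{1..d}.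
      (if i = last u then x (rev w @ [last u]) * lnest w (butlast u) else 0)
      - (if i = hd u then x (rev w @ [hd u]) * lnest w (tl u) else 0))"
    by (subst sum.swap) (auto intro!: sum.cong simp: algebra_simps)
  also have "\<dots> = (\<Sum>w\<in>lwords d (Suc n). x (rev w @ [last u]) * lnest w (butlast u))
      - (\<Sum>w\<in>lwords d (Suc n). x (rev w @ [hd u]) * lnest w (tl u))"
    using hl by (simp add: sum_subtractf)
  also have "\<dots> = dynkin_adj (\<lambda>z. x (z @ [last u])) (butlast u)
      - dynkin_adj (\<lambda>z. x (z @ [hd u])) (tl u)"
  proof -
    have "set (butlast u) \<subseteq> {1..d}" "set (tl u) \<subseteq> {1..d}"
      using Suc.prems(1) by (meson in_set_butlastD subset_iff, metis list.set_sel(2) ne subset_iff)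
    then show ?thesis using Suc.prems(2) Suc.IH[of "butlast u" "\<lambda>z. x (z @ [last u])"]
        Suc.IH[of "tl u" "\<lambda>z. x (z @ [hd u])"] by simp
  qed
  also have "\<dots> = dynkin_adj x u" using dynkin_adj_rec[OF Suc.prems(2)] by simp
  finally show ?case .
qed

text \<open>A shuffle of \<open>rev (take k u)\<close> with \<open>drop k u\<close> begins with
  \<open>u ! (k - 1)\<close> or \<open>u ! k\<close>, so it equals \<open>C (k - 1) + C k\<close>.
  With alternating signs the weights \<open>n - k\<close> leave each \<open>C j\<close> the factor
  \<open>(n - j) - (n - j - 1) = 1\<close>.\<close>

lemma dynkin_adj_primitive:
  assumes "primitive x"
  shows "dynkin_adj x u = real (length u) * x u"
proof -
  define n where "n = length u"
  define C where "C j = shp (\<lambda>z. x (u ! j # z)) (rev (take j u)) (drop (Suc j) u)" for j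
  have eq: "shp x (rev (take k u)) (drop k u)
      = (if k = 0 then 0 else C (k - 1)) + (if k < n then C k else 0)" if "k \<le> n" "u \<noteq> []" for k
  proof (cases k)
    case 0
    then show ?thesis using that by (cases u) (simp_all add: C_def n_def)
  next
    case (Suc m)
    then have m: "rev (take k u) = u ! m # rev (take m u)"
      using that by (simp add: take_Suc_conv_app_nth n_def)
    show ?thesis
    proof (cases "k < n")
      case True
      then have "drop k u = u ! k # drop (Suc k) u" by (simp add: Cons_nth_drop_Suc n_def)
      then show ?thesis using True Suc m by (simp add: C_def shp_Cons)
    next
      case False
      then have "k = n" "drop k u = []" using that by (simp_all add: n_def)
      moreover from this have "n - 1 = m" "n \<noteq> 0" using Suc by auto
      ultimately show ?thesis unfolding m by (simp add: C_def n_def)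
    qed
  qed
  have van: "shp x (rev (take k u)) (drop k u) = 0" if "k \<noteq> 0" "k < n" for k
  proof -
    have "rev (take k u) \<noteq> []" "drop k u \<noteq> []" using that by (auto simp: n_def)
    then show ?thesis using assms unfolding primitive_def by blast
  qed
  show ?thesis
  proof (cases "u = []")
    case False
    \<comment> \<open>Primitivity covers \<open>0 < k < n\<close>; the term \<open>k = n\<close>
      disappears through its weight.\<close>
    have "real n * x u = (\<Sum>k\<le>n. (- 1) ^ k * real (n - k) * shp x (rev (take k u)) (drop k u))"
    proof -
      have "(\<Sum>k\<le>n. (- 1) ^ k * real (n - k) * shp x (rev (take k u)) (drop k u))
        = (\<Sum>k\<le>n. if k = 0 then real n * x u else 0)"
        by (rule sum.cong) (use van in \<open>auto simp: le_less\<close>)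
      then show ?thesis by simp
    qed
    also have "\<dots> = (\<Sum>k\<le>n. if k = 0 then 0 else (- 1) ^ k * real (n - k) * C (k - 1))
        + (\<Sum>k\<le>n. if k < n then (- 1) ^ k * real (n - k) * C k else 0)"
      unfolding sum.distrib[symmetric]
      by (rule sum.cong) (use eq False in \<open>auto simp: algebra_simps\<close>)
    also have "(\<Sum>k\<le>n. if k = 0 then 0 else (- 1) ^ k * real (n - k) * C (k - 1))
        = (\<Sum>j<n. - ((- 1) ^ j) * real (n - Suc j) * C j)"
      by (subst sum.atMost_shift) (auto intro!: sum.cong)
    also have "(\<Sum>k\<le>n. if k < n then (- 1) ^ k * real (n - k) * C k else 0)
        = (\<Sum>j<n. (- 1) ^ j * real (n - j) * C j)"
      unfolding lessThan_Suc_atMost[symmetric] by (subst sum.lessThan_Suc) auto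
    also have "(\<Sum>j<n. - ((- 1) ^ j) * real (n - Suc j) * C j) + (\<Sum>j<n. (- 1) ^ j * real (n - j) * C j)
        = (\<Sum>j<n. (- 1) ^ j * C j)"
      unfolding sum.distrib[symmetric]
    proof (rule sum.cong)
      fix j assume "j \<in> {..<n}"
      then have "real (n - j) = real (n - Suc j) + 1" by auto
      then show "- ((- 1) ^ j) * real (n - Suc j) * C j + (- 1) ^ j * real (n - j) * C j = (- 1) ^ j * C j"
        by (simp add: algebra_simps)
    qed simp
    finally show ?thesis by (simp add: dynkin_adj_def C_def n_def)
  qed (simp add: dynkin_adj_def)
qed

text \<open>The inductive closure has no clause for zero, which arises as zero times a letter; hence
  a non-empty alphabet.\<close>

lemma lie_zero: "d \<ge> 1 \<Longrightarrow> lie d (\<lambda>w. 0)"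
  using lie_scale[OF lie_letter[of 1 d], of 0] by simp

lemma lie_sum:
  assumes "d \<ge> 1" "finite A" "\<And>a. a \<in> A \<Longrightarrow> lie d (g a)"
  shows "lie d (\<lambda>w. \<Sum>a\<in>A. g a w)"
  using assms(2,3)
  by (induction A rule: finite_induct) (auto intro: lie_add lie_zero[OF assms(1)])

lemma lie_lnest: "d \<ge> 1 \<Longrightarrow> set w \<subseteq> {1..d} \<Longrightarrow> lie d (lnest w)"
  by (induction w rule: lnest.induct) (auto intro!: lie_zero lie_letter lie_bracket)

lemma tmul_neq_0:
  assumes "tmul a b w \<noteq> 0"
  obtains p q where "w = p @ q" "a p \<noteq> 0" "b q \<noteq> 0"
proof -
  obtain k where "a (take k w) * b (drop k w) \<noteq> 0"
    using assms unfolding tmul_def by (meson sum.neutral)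
  then show ?thesis using that[of "take k w" "drop k w"] by auto
qed

lemma lnest_support: "lnest w u \<noteq> 0 \<Longrightarrow> length u = length w \<and> set u \<subseteq> set w"
proof (induction w arbitrary: u rule: lnest.induct)
  case (2 i)
  then show ?case by (auto simp: letter_def split: if_splits)
next
  case (3 i j w)
  then have "tmul (lnest (j # w)) (letter i) u \<noteq> 0 \<or> tmul (letter i) (lnest (j # w)) u \<noteq> 0"
    by (auto simp: bracket_def)
  then show ?case
  proof
    assume "tmul (lnest (j # w)) (letter i) u \<noteq> 0"
    then obtain p q where "u = p @ q" "lnest (j # w) p \<noteq> 0" "letter i q \<noteq> 0" by (rule tmul_neq_0)
    then show ?thesis using 3(1)[of p] by (auto simp: letter_def split: if_splits)
  next
    assume "tmul (letter i) (lnest (j # w)) u \<noteq> 0"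
    then obtain q p where "u = q @ p" "lnest (j # w) p \<noteq> 0" "letter i q \<noteq> 0" by (rule tmul_neq_0)
    then show ?thesis using 3(1)[of p] by (auto simp: letter_def split: if_splits)
  qed
qed simp

lemma finite_words [simp]: "finite (words d n)"
  unfolding words_def by (rule finite_lists_length_le) simp

text \<open>On words of length \<open>n\<close> the Dynkin operator multiplies a primitive element
  by \<open>n\<close>, so dividing by the length exhibits it as a combination of nested brackets.
  Bounded support keeps that combination finite.\<close>

lemma primitive_imp_lie:
  assumes d: "d \<ge> 1" and x: "primitive x" and supp: "\<And>w. w \<notin> words d K \<Longrightarrow> x w = 0"
  shows "lie d x"
proof -
  \<comment> \<open>\<open>rev w\<close> matches the reading direction of \<open>lnest\<close>; at
    \<open>w = []\<close> the division by zero is harmless because \<open>lnest []\<close>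
    vanishes.\<close>
  define y where "y u = (\<Sum>w\<in>words d K. x (rev w) / real (length w) * lnest w u)" for u
  have "lie d y"
    unfolding y_def
    by (intro lie_sum lie_scale lie_lnest d finite_words) (auto simp: words_def)
  moreover have "y u = x u" for u
  proof (cases "u \<in> words d K \<and> u \<noteq> []")
    case False
    have "lnest w u = 0" if "w \<in> words d K" for w
    proof (rule ccontr)
      assume "lnest w u \<noteq> 0"
      with lnest_support[OF this] that False show False by (cases w) (auto simp: words_def)
    qed
    then have "y u = 0" by (simp add: y_def)
    then show ?thesis using False supp x by (auto simp: primitive_def)
  next
    case True
    then obtain n where n: "length u = Suc n" by (cases u) auto
    have "y u = (\<Sum>w\<in>lwords d (Suc n). x (rev w) / real (length w) * lnest w u)"
      unfolding y_def
    proof (rule sum.mono_neutral_right)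
      show "lwords d (Suc n) \<subseteq> words d K" using True n by (auto simp: words_def lwords_def)
      show "\<forall>w\<in>words d K - lwords d (Suc n). x (rev w) / real (length w) * lnest w u = 0"
        using lnest_support[of _ u] n by (auto simp: lwords_def words_def)
    qed simp
    also have "\<dots> = (\<Sum>w\<in>lwords d (Suc n). x (rev w) * lnest w u) / real (Suc n)"
      unfolding sum_divide_distrib by (rule sum.cong) (auto simp: lwords_def)
    also have "\<dots> = x u"
      using True n sum_lnest_eq_dynkin_adj[of u d n x] dynkin_adj_primitive[OF x, of u]
      by (simp add: words_def)
    finally show ?thesis .
  qed
  ultimately show ?thesis by (metis ext)
qed

section \<open>Smooth functions on an interval\<close>

text \<open>\<open>smooth_on\<close> asks for one infinite sequence of derivatives at once. A
  predicate for each finite order allows induction on the order, in particular for products.\<close>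

primrec Ck :: "real set \<Rightarrow> nat \<Rightarrow> (real \<Rightarrow> real) \<Rightarrow> bool" where
  "Ck S 0 f \<longleftrightarrow> True"
| "Ck S (Suc n) f \<longleftrightarrow>
    (\<exists>f'. (\<forall>x\<in>S. (f has_vector_derivative f' x) (at x within S)) \<and> Ck S n f')"

lemma Ck_Suc_imp: "Ck S (Suc n) f \<Longrightarrow> Ck S n f"
  by (induction n arbitrary: f) auto

lemma Ck_cong:
  assumes "Ck S n f" "\<And>x. x \<in> S \<Longrightarrow> f x = g x"
  shows "Ck S n g"
proof (cases n)
  case (Suc m)
  then obtain f' where f': "\<And>x. x \<in> S \<Longrightarrow> (f has_vector_derivative f' x) (at x within S)" "Ck S m f'"
    using assms(1) by auto
  have "(g has_vector_derivative f' x) (at x within S)" if "x \<in> S" for x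
    by (rule has_vector_derivative_transform[OF that _ f'(1)[OF that]]) (simp add: assms(2))
  then show ?thesis using f'(2) Suc by auto
qed simp

lemma Ck_add: "Ck S n f \<Longrightarrow> Ck S n g \<Longrightarrow> Ck S n (\<lambda>x. f x + g x)"
proof (induction n arbitrary: f g)
  case (Suc n)
  then obtain f' g' where
    "\<forall>x\<in>S. (f has_vector_derivative f' x) (at x within S)" "Ck S n f'"
    "\<forall>x\<in>S. (g has_vector_derivative g' x) (at x within S)" "Ck S n g'" by auto
  then show ?case using Suc.IH[of f' g']
    by (auto intro!: exI[of _ "\<lambda>x. f' x + g' x"] has_vector_derivative_add)
qed simp

lemma Ck_mult: "Ck S n f \<Longrightarrow> Ck S n g \<Longrightarrow> Ck S n (\<lambda>x. f x * g x)"
proof (induction n arbitrary: f g)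
  case (Suc n)
  then obtain f' g' where
    "\<forall>x\<in>S. (f has_vector_derivative f' x) (at x within S)" "Ck S n f'"
    "\<forall>x\<in>S. (g has_vector_derivative g' x) (at x within S)" "Ck S n g'" by auto
  moreover have "Ck S n f" "Ck S n g" using Suc.prems Ck_Suc_imp by blast+
  ultimately show ?case using Suc.IH[of f g'] Suc.IH[of f' g]
    by (auto intro!: exI[of _ "\<lambda>x. f x * g' x + f' x * g x"] has_vector_derivative_mult Ck_add)
qed simp

lemma Ck_const: "Ck S n (\<lambda>x. c)"
proof (induction n arbitrary: c)
  case (Suc n)
  then show ?case by (auto intro!: exI[of _ "\<lambda>x. 0"])
qed simp

text \<open>Derivatives within a nondegenerate interval are unique, so the witnesses of different
  orders agree on it and fit into a single sequence.\<close>

lemma smooth_on_iff_Ck: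
  fixes f :: "real \<Rightarrow> real"
  assumes "0 < T"
  shows "smooth_on {0..T} f \<longleftrightarrow> (\<forall>n. Ck {0..T} n f)"
proof
  assume "smooth_on {0..T} f"
  then obtain D where D: "D 0 = f"
    "\<And>k x. x \<in> {0..T} \<Longrightarrow> (D k has_vector_derivative D (Suc k) x) (at x within {0..T})"
    unfolding smooth_on_def by auto
  have "Ck {0..T} n (D k)" for n k
    by (induction n arbitrary: k) (auto intro!: exI[of _ "D (Suc _)"] D(2))
  then show "\<forall>n. Ck {0..T} n f" using D(1) by metis
next
  assume f: "\<forall>n. Ck {0..T} n f"
  define D where "D = rec_nat f (\<lambda>_ g x. vector_derivative g (at x within {0..T}))"
  have D0: "D 0 = f" and DS: "D (Suc k) = (\<lambda>x. vector_derivative (D k) (at x within {0..T}))" for k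
    by (simp_all add: D_def)
  have step: "(\<forall>x\<in>{0..T}. (D k has_vector_derivative D (Suc k) x) (at x within {0..T})) \<and>
      Ck {0..T} n (D (Suc k))" if "Ck {0..T} (Suc n) (D k)" for n k
  proof -
    obtain f' where f': "\<And>x. x \<in> {0..T} \<Longrightarrow> (D k has_vector_derivative f' x) (at x within {0..T})"
      "Ck {0..T} n f'" using \<open>Ck {0..T} (Suc n) (D k)\<close> by (auto simp del: atLeastAtMost_iff)
    have "D (Suc k) x = f' x" if "x \<in> {0..T}" for x
      unfolding DS using vector_derivative_within_closed_interval[OF assms that f'(1)[OF that]] .
    then show ?thesis using f' Ck_cong[OF f'(2), of "D (Suc k)"] by auto
  qed
  have "Ck {0..T} n (D k)" for n k
    by (induction k arbitrary: n) (use f D0 step in blast)+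
  then show "smooth_on {0..T} f"
    unfolding smooth_on_def using D0 step by blast
qed

lemma smooth_on_cong:
  fixes f :: "real \<Rightarrow> real"
  assumes "0 < T" "smooth_on {0..T} f" "\<And>x. x \<in> {0..T} \<Longrightarrow> f x = g x"
  shows "smooth_on {0..T} g"
  using assms Ck_cong[of "{0..T}" _ f g] by (auto simp: smooth_on_iff_Ck)

lemma smooth_on_const: "0 < T \<Longrightarrow> smooth_on {0..T} (\<lambda>x. c :: real)"
  by (simp add: smooth_on_iff_Ck Ck_const)

lemma smooth_on_add:
  fixes f g :: "real \<Rightarrow> real"
  shows "0 < T \<Longrightarrow> smooth_on {0..T} f \<Longrightarrow> smooth_on {0..T} g \<Longrightarrow> smooth_on {0..T} (\<lambda>x. f x + g x)"
  by (simp add: smooth_on_iff_Ck Ck_add)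

lemma smooth_on_mult:
  fixes f g :: "real \<Rightarrow> real"
  shows "0 < T \<Longrightarrow> smooth_on {0..T} f \<Longrightarrow> smooth_on {0..T} g \<Longrightarrow> smooth_on {0..T} (\<lambda>x. f x * g x)"
  by (simp add: smooth_on_iff_Ck Ck_mult)

lemma smooth_on_diff:
  fixes f g :: "real \<Rightarrow> real"
  assumes "0 < T" "smooth_on {0..T} f" "smooth_on {0..T} g"
  shows "smooth_on {0..T} (\<lambda>x. f x - g x)"
  using smooth_on_add[OF assms(1,2) smooth_on_mult[OF assms(1) smooth_on_const[OF assms(1), of "-1"] assms(3)]]
  by simp

lemma smooth_on_sum:
  fixes f :: "'i \<Rightarrow> real \<Rightarrow> real"
  assumes "0 < T" "\<And>i. i \<in> I \<Longrightarrow> smooth_on {0..T} (f i)"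
  shows "smooth_on {0..T} (\<lambda>x. \<Sum>i\<in>I. f i x)"
  using assms(2)
  by (induction I rule: infinite_finite_induct)
    (simp_all add: smooth_on_const smooth_on_add assms(1))

lemma smooth_on_antideriv:
  fixes f :: "real \<Rightarrow> real"
  assumes "0 < T" "smooth_on {0..T} f'"
    and "\<And>x. x \<in> {0..T} \<Longrightarrow> (f has_vector_derivative f' x) (at x within {0..T})"
  shows "smooth_on {0..T} f"
proof -
  have "Ck {0..T} n f" for n
    using assms by (cases n) (auto simp: smooth_on_iff_Ck simp del: atLeastAtMost_iff)
  then show ?thesis by (simp add: smooth_on_iff_Ck assms(1))
qed

lemma smooth_on_deriv:
  fixes f :: "real \<Rightarrow> real"
  assumes "0 < T" "smooth_on {0..T} f"
    and "\<And>x. x \<in> {0..T} \<Longrightarrow> (f has_vector_derivative f' x) (at x within {0..T})"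
  shows "smooth_on {0..T} f'"
proof -
  have "Ck {0..T} n f'" for n
  proof -
    have "Ck {0..T} (Suc n) f" using assms by (simp add: smooth_on_iff_Ck del: Ck.simps)
    then obtain g where g: "\<And>x. x \<in> {0..T} \<Longrightarrow> (f has_vector_derivative g x) (at x within {0..T})"
      "Ck {0..T} n g" by (auto simp del: atLeastAtMost_iff)
    have "g x = f' x" if "x \<in> {0..T}" for x
      using vector_derivative_within_closed_interval[OF assms(1) that] g(1) assms(3) that by metis
    then show ?thesis using Ck_cong g(2) by blast
  qed
  then show ?thesis by (simp add: smooth_on_iff_Ck assms(1))
qed

lemma smooth_on_has_vector_derivative:
  fixes f :: "real \<Rightarrow> real"
  assumes "0 < T" "smooth_on {0..T} f" "x \<in> {0..T}"
  shows "(f has_vector_derivative vector_derivative f (at x within {0..T})) (at x within {0..T})"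
proof -
  obtain D where D: "D 0 = f" "(D 0 has_vector_derivative D (Suc 0) x) (at x within {0..T})"
    using assms unfolding smooth_on_def by blast
  then show ?thesis using vector_derivative_within_closed_interval[OF assms(1,3)] by metis
qed

lemma smooth_on_continuous_on:
  fixes f :: "real \<Rightarrow> real"
  assumes "0 < T" "smooth_on {0..T} f"
  shows "continuous_on {0..T} f"
  using smooth_on_has_vector_derivative[OF assms] has_vector_derivative_continuous
  unfolding continuous_on_eq_continuous_within by blast

section \<open>Semigroups of tensors\<close>

lemma tmul_no_const:
  assumes "b [] = 0"
  shows "tmul a b w = (\<Sum>i<length w. a (take i w) * b (drop i w))"
  unfolding tmul_def lessThan_Suc_atMost[symmetric] by (simp add: assms)

lemma shp_has_vector_derivative:
  assumes "\<And>w. ((\<lambda>t. x t w) has_vector_derivative y w) F"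
  shows "((\<lambda>t. shp (x t) u v) has_vector_derivative shp y u v) F"
proof -
  have "((\<lambda>t. sum_list (map (x t) ws)) has_vector_derivative sum_list (map y ws)) F" for ws
    by (induction ws) (auto intro!: has_vector_derivative_add assms)
  then show ?thesis by (simp add: shp_def)
qed

text \<open>The predicate \<open>B\<close> on word lengths is \<open>\<lambda>n. n \<le> N\<close> for an \<open>N\<close>-sgrm and
  \<open>\<lambda>n. True\<close> for an sgrm.\<close>

locale tensor_path =
  fixes T :: real and d :: nat and B :: "nat \<Rightarrow> bool" and X :: "real \<Rightarrow> real \<Rightarrow> tensor"
  assumes T: "0 < T"
    and B0: "B 0" and B_down: "B n \<Longrightarrow> m \<le> n \<Longrightarrow> B m"
    and nonzero: "\<exists>s\<in>{0..T}. \<exists>t\<in>{0..T}. X s t \<noteq> (\<lambda>w. 0)"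
    and alphabet: "s \<in> {0..T} \<Longrightarrow> t \<in> {0..T} \<Longrightarrow> \<not> set w \<subseteq> {1..d} \<Longrightarrow> X s t w = 0"
    and level: "s \<in> {0..T} \<Longrightarrow> t \<in> {0..T} \<Longrightarrow> \<not> B (length w) \<Longrightarrow> X s t w = 0"
    and pair_sh: "s \<in> {0..T} \<Longrightarrow> t \<in> {0..T} \<Longrightarrow> set u \<subseteq> {1..d} \<Longrightarrow> set w \<subseteq> {1..d} \<Longrightarrow>
        B (length u + length w) \<Longrightarrow> pair_sh (X s t) u w = X s t u * X s t w"
    and chen: "s \<in> {0..T} \<Longrightarrow> r \<in> {0..T} \<Longrightarrow> t \<in> {0..T} \<Longrightarrow> B (length w) \<Longrightarrow>
        tmul (X s r) (X r t) w = X s t w"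
    and smooth: "s \<in> {0..T} \<Longrightarrow> smooth_on {0..T} (\<lambda>t. X s t w)"
begin

lemma shuffle_character:
  assumes "s \<in> {0..T}" "t \<in> {0..T}" "B (length u + length w)"
  shows "shp (X s t) u w = X s t u * X s t w"
proof (cases "set u \<subseteq> {1..d} \<and> set w \<subseteq> {1..d}")
  case True
  then show ?thesis using pair_sh assms by (simp add: pair_sh_eq_shp)
next
  case False
  have "shp (X s t) u w = 0"
    by (rule shp_eq_0, rule alphabet) (use False assms in auto)
  moreover have "X s t u = 0 \<or> X s t w = 0" using alphabet False assms by blast
  ultimately show ?thesis by auto
qed

text \<open>The coefficient satisfies \<open>c = c * c\<close>. Were it 0 at one pair, Chen's
  relation through that pair would make it 0 at every pair, and shuffling with the empty word would
  annihilate the whole path.\<close>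

lemma at_Nil:
  assumes s: "s \<in> {0..T}" and t: "t \<in> {0..T}"
  shows "X s t [] = 1"
proof (rule ccontr)
  assume "X s t [] \<noteq> 1"
  moreover have "X s t [] = X s t [] * X s t []"
    using shuffle_character[OF s t, of "[]" "[]"] B0 by simp
  ultimately have z: "X s t [] = 0" by auto
  have "X a b w = 0" if ab: "a \<in> {0..T}" "b \<in> {0..T}" for a b w
  proof -
    have "X a b [] = X a s [] * (X s t [] * X t b [])"
      using chen[OF ab(1) s ab(2), of "[]"] chen[OF s t ab(2), of "[]"] B0 by simp
    then have "X a b [] = 0" using z by simp
    then show ?thesis
      using shuffle_character[OF ab, of "[]" w] level[OF ab, of w] by (cases "B (length w)") auto
  qed
  then show False using nonzero by blast
qed

text \<open>\<open>X s s\<close> is idempotent with constant term 1. Once shorter coefficients are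
  those of the unit, idempotence at a non-empty \<open>w\<close> reads
  \<open>X s s w = 2 * X s s w\<close>.\<close>

lemma at_refl:
  assumes s: "s \<in> {0..T}" and "B (length w)"
  shows "X s s w = tunit w"
  using assms(2)
proof (induction "length w" arbitrary: w rule: less_induct)
  case less
  show ?case
  proof (cases w)
    case Nil
    then show ?thesis by (simp add: at_Nil[OF s s] tunit_def)
  next
    case (Cons h t)
    have "X s s (drop i t) = tunit (drop i t)" for i
      using less B_down[of "length w" "length t - i"] by (simp add: Cons)
    then have "tmul (\<lambda>z. X s s (h # z)) (X s s) t = tmul (\<lambda>z. X s s (h # z)) tunit t"
      unfolding tmul_def by simp
    then have "X s s w = X s s w + X s s w"
      using chen[OF s s s less.prems] by (simp add: Cons tmul_Cons at_Nil[OF s s])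
    then show ?thesis by (simp add: Cons tunit_def)
  qed
qed

lemma diag_has_vector_derivative:
  assumes "s \<in> {0..T}"
  shows "((\<lambda>t. X s t w) has_vector_derivative diag T X s w) (at s within {0..T})"
  unfolding diag_def using smooth_on_has_vector_derivative[OF T smooth[OF assms] assms] .

text \<open>Chen's relation writes \<open>X s r\<close> as \<open>X s t\<close> times
  \<open>X t r\<close>, which moves the derivative at \<open>t\<close> to the diagonal.\<close>

lemma flow:
  assumes s: "s \<in> {0..T}" and t: "t \<in> {0..T}" and w: "B (length w)"
  shows "((\<lambda>t. X s t w) has_vector_derivative tmul (X s t) (diag T X t) w) (at t within {0..T})"
proof (rule has_vector_derivative_transform[OF t])
  show "\<And>r. r \<in> {0..T} \<Longrightarrow> X s r w = tmul (X s t) (X t r) w" using chen[OF s t _ w] by simp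
  show "((\<lambda>r. tmul (X s t) (X t r) w) has_vector_derivative tmul (X s t) (diag T X t) w) (at t within {0..T})"
    unfolding tmul_def
    by (intro has_vector_derivative_sum has_vector_derivative_mult_right diag_has_vector_derivative t)
qed

lemma diag_eqI:
  assumes "s \<in> {0..T}" "((\<lambda>t. X s t w) has_vector_derivative c) (at s within {0..T})"
  shows "diag T X s w = c"
  unfolding diag_def using vector_derivative_within_closed_interval[OF T assms] .

lemma diag_eq_0:
  assumes "s \<in> {0..T}" "\<And>t. t \<in> {0..T} \<Longrightarrow> X s t w = c"
  shows "diag T X s w = 0"
  by (rule diag_eqI[OF assms(1)], rule has_vector_derivative_transform[OF assms(1) assms(2)]) auto

lemma diag_Nil: "s \<in> {0..T} \<Longrightarrow> diag T X s [] = 0"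
  by (rule diag_eq_0) (auto intro: at_Nil)

lemma diag_alphabet: "s \<in> {0..T} \<Longrightarrow> \<not> set w \<subseteq> {1..d} \<Longrightarrow> diag T X s w = 0"
  using diag_eq_0 alphabet by blast

lemma diag_level: "s \<in> {0..T} \<Longrightarrow> \<not> B (length w) \<Longrightarrow> diag T X s w = 0"
  using diag_eq_0 level by blast

text \<open>At the diagonal the product rule leaves terms with a factor \<open>X s s u\<close> or
  \<open>X s s v\<close>, zero for non-empty words. Above the level there is no shuffle relation,
  but there the derivative itself is zero.\<close>

lemma diag_primitive:
  assumes s: "s \<in> {0..T}"
  shows "primitive (diag T X s)"
  unfolding primitive_def
proof (intro conjI allI impI diag_Nil s)
  fix u v :: word assume uv: "u \<noteq> []" "v \<noteq> []"
  show "shp (diag T X s) u v = 0"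
  proof (cases "B (length u + length v)")
    case True
    then have b: "B (length u)" "B (length v)" using B_down by auto
    have "((\<lambda>t. X s t u * X s t v) has_vector_derivative X s s u * diag T X s v + diag T X s u * X s s v)
        (at s within {0..T})"
      by (intro has_vector_derivative_mult diag_has_vector_derivative s)
    then have 1: "((\<lambda>t. X s t u * X s t v) has_vector_derivative 0) (at s within {0..T})"
      using at_refl[OF s b(1)] at_refl[OF s b(2)] uv by (simp add: tunit_def)
    have 2: "((\<lambda>t. shp (X s t) u v) has_vector_derivative shp (diag T X s) u v) (at s within {0..T})"
      by (rule shp_has_vector_derivative) (rule diag_has_vector_derivative[OF s])
    have "((\<lambda>t. shp (X s t) u v) has_vector_derivative 0) (at s within {0..T})"
      by (rule has_vector_derivative_transform[OF s _ 1]) (use shuffle_character[OF s] True in simp)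
    then show ?thesis
      using vector_derivative_within_closed_interval[OF T s] 2 by metis
  next
    case False
    then show ?thesis by (intro shp_eq_0 diag_level s) auto
  qed
qed

text \<open>Smoothness is assumed in the second argument only, while the diagonal moves both. The
  flow from base point 0 has a smooth left-hand side; solving it for \<open>diag T X s w\<close>
  leaves products with the derivative at shorter words.\<close>

lemma smooth_diag: "smooth_on {0..T} (\<lambda>s. diag T X s w)"
proof (cases "B (length w)")
  case True
  have 0: "0 \<in> {0..T}" using T by simp
  show ?thesis using True
  proof (induction "length w" arbitrary: w rule: less_induct)
    case less
    show ?case
    proof (cases w)
      case Nil
      then show ?thesis using smooth_on_cong[OF T smooth_on_const[OF T, of 0]] diag_Nil by auto
    next
      case (Cons h t)
      let ?r = "\<lambda>s. \<Sum>i\<le>length t. X 0 s (h # take i t) * diag T X s (drop i t)"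
      have "smooth_on {0..T} (\<lambda>s. tmul (X 0 s) (diag T X s) w)"
        by (rule smooth_on_deriv[OF T smooth[OF 0] flow[OF 0 _ less.prems]])
      moreover have "smooth_on {0..T} ?r"
        by (intro smooth_on_sum smooth_on_mult T smooth 0 less.hyps)
          (use Cons less.prems B_down[of "length w"] in auto)
      ultimately have "smooth_on {0..T} (\<lambda>s. tmul (X 0 s) (diag T X s) w - ?r s)"
        by (rule smooth_on_diff[OF T])
      then show ?thesis
        by (rule smooth_on_cong[OF T])
          (simp add: Cons tmul_Cons at_Nil[OF 0] tmul_def[of "\<lambda>z. X 0 _ (h # z)"] del: atLeastAtMost_iff)
    qed
  qed
next
  case False
  then show ?thesis using smooth_on_cong[OF T smooth_on_const[OF T, of 0]] diag_level by auto
qed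

end

lemma nsgrm_tensor_path:
  assumes "0 < T" "nsgrm T d N W"
  shows "tensor_path T d (\<lambda>n. n \<le> N) W"
proof
  note W = assms(2)[unfolded nsgrm_def]
  fix s t u :: real and w :: word
  assume st: "s \<in> {0..T}" "t \<in> {0..T}"
  show "W s t w = 0" if "\<not> set w \<subseteq> {1..d}" using W st that by (auto simp: words_def)
  show "W s t w = 0" if "\<not> length w \<le> N" using W st that by (auto simp: words_def)
  show "tmul (W s u) (W u t) w = W s t w" if "u \<in> {0..T}" "length w \<le> N"
  proof -
    have "tmulN N (W s u) (W u t) = W s t" using W st that by blast
    then show ?thesis using that by (metis tmulN_def proj_def)
  qed
qed (use assms in \<open>auto simp: nsgrm_def\<close>)

lemma sgrm_tensor_path:
  assumes "0 < T" "sgrm T d X"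
  shows "tensor_path T d (\<lambda>n. True) X"
  using assms by unfold_locales (auto simp: sgrm_def)

section \<open>Minimal extensions\<close>

text \<open>As \<open>x t []\<close> vanishes, the derivative of a coefficient depends only on
  proper prefixes. The predicate \<open>B\<close> permits comparing an \<open>N\<close>-sgrm with a
  full one on words of length at most \<open>N\<close>.\<close>

lemma ode_unique:
  fixes f g x :: "real \<Rightarrow> tensor"
  assumes B_down: "\<And>n m. B n \<Longrightarrow> m \<le> n \<Longrightarrow> B m"
    and x: "\<And>t. t \<in> {0..T} \<Longrightarrow> x t [] = 0"
    and f: "\<And>t w. t \<in> {0..T} \<Longrightarrow> B (length w) \<Longrightarrow>
      ((\<lambda>t. f t w) has_vector_derivative tmul (f t) (x t) w) (at t within {0..T})"
    and g: "\<And>t w. t \<in> {0..T} \<Longrightarrow> B (length w) \<Longrightarrow>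
      ((\<lambda>t. g t w) has_vector_derivative tmul (g t) (x t) w) (at t within {0..T})"
    and s: "s \<in> {0..T}" and init: "\<And>w. B (length w) \<Longrightarrow> f s w = g s w"
    and w: "B (length w)" and t: "t \<in> {0..T}"
  shows "f t w = g t w"
  using w t
proof (induction "length w" arbitrary: w t rule: less_induct)
  case less
  have "((\<lambda>t. f t w - g t w) has_vector_derivative 0) (at r within {0..T})" if r: "r \<in> {0..T}" for r
  proof -
    have "f r (take i w) = g r (take i w)" if "i < length w" for i
      using less.hyps[of "take i w" r] that r B_down[OF less.prems(1), of i] by simp
    then have "tmul (f r) (x r) w = tmul (g r) (x r) w"
      by (simp add: tmul_no_const[of "x r", OF x[OF r]])
    then show ?thesis
      using has_vector_derivative_diff[OF f[OF r less.prems(1)] g[OF r less.prems(1)]] by simp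
  qed
  then obtain c where "\<And>r. r \<in> {0..T} \<Longrightarrow> f r w - g r w = c"
    using has_vector_derivative_zero_constant[of "{0..T}" "\<lambda>t. f t w - g t w"] by auto
  from this[OF s] this[OF less.prems(2)] init[OF less.prems(1)] show ?case by simp
qed

text \<open>Difference of two integrals from 0, because \<open>t < s\<close> is allowed.\<close>

function iter_int :: "(real \<Rightarrow> tensor) \<Rightarrow> real \<Rightarrow> word \<Rightarrow> real \<Rightarrow> real" where
  "iter_int x s w = (\<lambda>t. tunit w
      + integral {0..t} (\<lambda>r. \<Sum>i<length w. iter_int x s (take i w) r * x r (drop i w))
      - integral {0..s} (\<lambda>r. \<Sum>i<length w. iter_int x s (take i w) r * x r (drop i w)))"
  by pat_completeness auto
termination by (relation "Wellfounded.measure (\<lambda>(x, s, w). length w)") auto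

declare iter_int.simps [simp del]

locale control =
  fixes T :: real and d :: nat and x :: "real \<Rightarrow> tensor"
  assumes T: "0 < T"
    and x_primitive: "t \<in> {0..T} \<Longrightarrow> primitive (x t)"
    and x_alphabet: "t \<in> {0..T} \<Longrightarrow> \<not> set w \<subseteq> {1..d} \<Longrightarrow> x t w = 0"
    and x_smooth: "smooth_on {0..T} (\<lambda>t. x t w)"
begin

definition Z :: "real \<Rightarrow> real \<Rightarrow> tensor" where
  "Z s t = (\<lambda>w. iter_int x s w t)"

lemma x_Nil: "t \<in> {0..T} \<Longrightarrow> x t [] = 0"
  using x_primitive by (auto simp: primitive_def)

lemma Z_refl: "Z s s = tunit"
  by (rule ext, unfold Z_def, subst iter_int.simps) simp

text \<open>The two claims share one induction: smooth coefficients at shorter prefixes give a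
  smooth integrand, whose continuity yields the derivative and whose smoothness passes to the
  integral.\<close>

lemma Z_smooth_flow:
  "smooth_on {0..T} (\<lambda>t. Z s t w) \<and>
    (\<forall>t\<in>{0..T}. ((\<lambda>t. Z s t w) has_vector_derivative tmul (Z s t) (x t) w) (at t within {0..T}))"
proof (induction "length w" arbitrary: w rule: less_induct)
  case less
  define g where "g r = (\<Sum>i<length w. Z s r (take i w) * x r (drop i w))" for r
  have g: "smooth_on {0..T} g"
    unfolding g_def
    by (intro smooth_on_sum smooth_on_mult T x_smooth conjunct1[OF less]) auto
  have eq: "(\<lambda>t. Z s t w) = (\<lambda>t. tunit w + integral {0..t} g - integral {0..s} g)"
    unfolding Z_def by (subst iter_int.simps) (simp add: g_def[abs_def] Z_def)
  have der: "((\<lambda>t. Z s t w) has_vector_derivative g t) (at t within {0..T})" if "t \<in> {0..T}" for t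
  proof -
    have "((\<lambda>t. tunit w + integral {0..t} g - integral {0..s} g) has_vector_derivative 0 + g t - 0) (at t within {0..T})"
      by (intro has_vector_derivative_add has_vector_derivative_diff has_vector_derivative_const
          integral_has_vector_derivative smooth_on_continuous_on[OF T g] that)
    then show ?thesis by (simp add: eq)
  qed
  moreover have "g t = tmul (Z s t) (x t) w" if "t \<in> {0..T}" for t
    by (simp add: g_def tmul_no_const[of "x t", OF x_Nil[OF that]])
  ultimately show ?case using smooth_on_antideriv[OF T g der] by auto
qed

lemmas Z_smooth = conjunct1[OF Z_smooth_flow]
lemmas Z_flow = bspec[OF conjunct2[OF Z_smooth_flow]]

lemma zero_deriv_unique:
  assumes "\<And>t. t \<in> {0..T} \<Longrightarrow> (f has_vector_derivative (0 :: real)) (at t within {0..T})"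
    and "s \<in> {0..T}" "t \<in> {0..T}"
  shows "f t = f s"
  using has_vector_derivative_zero_constant[of "{0..T}" f] assms by auto

lemma Z_alphabet:
  assumes s: "s \<in> {0..T}" and t: "t \<in> {0..T}" and w: "\<not> set w \<subseteq> {1..d}"
  shows "Z s t w = 0"
  using w t
proof (induction "length w" arbitrary: w t rule: less_induct)
  case less
  have "tmul (Z s r) (x r) w = 0" if r: "r \<in> {0..T}" for r
    unfolding tmul_no_const[of "x r", OF x_Nil[OF r]]
  proof (intro sum.neutral ballI)
    fix i assume i: "i \<in> {..<length w}"
    have "set w = set (take i w) \<union> set (drop i w)" by (metis append_take_drop_id set_append)
    then have "\<not> set (take i w) \<subseteq> {1..d} \<or> \<not> set (drop i w) \<subseteq> {1..d}" using less.prems(1) by blast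
    then show "Z s r (take i w) * x r (drop i w) = 0"
      using less.hyps[of "take i w" r] r i x_alphabet[OF r] by auto
  qed
  then have "Z s t w = Z s s w"
    using zero_deriv_unique[of "\<lambda>t. Z s t w"] Z_flow[of _ s w] s less.prems(2) by metis
  then show ?case using less.prems(1) by (auto simp: Z_refl tunit_def)
qed

text \<open>The control multiplies from the right, so left multiplication by \<open>Z s u\<close>
  preserves the equation; both sides agree at \<open>t = u\<close>.\<close>

lemma Z_chen:
  assumes "s \<in> {0..T}" "u \<in> {0..T}" "t \<in> {0..T}"
  shows "tmul (Z s u) (Z u t) = Z s t"
proof
  fix w
  show "tmul (Z s u) (Z u t) w = Z s t w"
  proof (rule ode_unique[where B = "\<lambda>_. True" and x = x and s = u and T = T
        and f = "\<lambda>r. tmul (Z s u) (Z u r)" and g = "\<lambda>r. Z s r"])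
    show "((\<lambda>r. tmul (Z s u) (Z u r) w) has_vector_derivative tmul (tmul (Z s u) (Z u r)) (x r) w)
        (at r within {0..T})" if r: "r \<in> {0..T}" for r w
    proof -
    have "((\<lambda>r. tmul (Z s u) (Z u r) w) has_vector_derivative tmul (Z s u) (tmul (Z u r) (x r)) w)
        (at r within {0..T})"
      unfolding tmul_def[of "Z s u"]
      by (intro has_vector_derivative_sum has_vector_derivative_mult_right Z_flow r)
    then show ?thesis by (simp add: tmul_assoc)
    qed
  qed (use assms x_Nil Z_flow in \<open>auto simp: Z_refl\<close>)
qed

lemma shp_x: "t \<in> {0..T} \<Longrightarrow> u \<noteq> [] \<Longrightarrow> v \<noteq> [] \<Longrightarrow> shp (x t) u v = 0"
  using x_primitive by (auto simp: primitive_def)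

text \<open>By \<open>shp_tmul\<close> the derivative of the left side is a sum over pairs of cuts.
  Primitivity of \<open>x r\<close> keeps those where one suffix is empty, and these form the
  product rule for the right side.\<close>

lemma Z_shuffle:
  assumes s: "s \<in> {0..T}" and t: "t \<in> {0..T}"
  shows "shp (Z s t) u v = Z s t u * Z s t v"
  using t
proof (induction "length u + length v" arbitrary: u v t rule: less_induct)
  case less
  have "((\<lambda>t. shp (Z s t) u v - Z s t u * Z s t v) has_vector_derivative 0) (at r within {0..T})"
    if r: "r \<in> {0..T}" for r
  proof -
    let ?S = "\<lambda>p q. shp (Z s r) (take p u) (take q v) * shp (x r) (drop p u) (drop q v)"
    have "((\<lambda>t. shp (Z s t) u v) has_vector_derivative shp (\<lambda>w. tmul (Z s r) (x r) w) u v) (at r within {0..T})"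
      by (rule shp_has_vector_derivative) (rule Z_flow[OF r])
    moreover have "((\<lambda>t. Z s t u * Z s t v) has_vector_derivative
        Z s r u * tmul (Z s r) (x r) v + tmul (Z s r) (x r) u * Z s r v) (at r within {0..T})"
      by (intro has_vector_derivative_mult Z_flow r)
    ultimately have "((\<lambda>t. shp (Z s t) u v - Z s t u * Z s t v) has_vector_derivative
        shp (tmul (Z s r) (x r)) u v - (Z s r u * tmul (Z s r) (x r) v + tmul (Z s r) (x r) u * Z s r v))
        (at r within {0..T})"
      by (rule has_vector_derivative_diff)
    moreover have "shp (tmul (Z s r) (x r)) u v = Z s r u * tmul (Z s r) (x r) v + tmul (Z s r) (x r) u * Z s r v"
    proof -
      \<comment> \<open>The corner where both suffixes are empty would be counted twice and is out
        of reach of the induction hypothesis; it vanishes because \<open>x r [] = 0\<close>.\<close>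
      have S: "?S p q = (if p = length u then Z s r u * (Z s r (take q v) * x r (drop q v)) else 0)
          + (if q = length v then Z s r (take p u) * x r (drop p u) * Z s r v else 0)"
        if p: "p \<le> length u" and q: "q \<le> length v" for p q
      proof -
        consider "p = length u" "q = length v" | "p = length u" "q < length v"
          | "p < length u" "q = length v" | "p < length u" "q < length v" using p q by linarith
        then show ?thesis
        proof cases
          case 1 then show ?thesis using x_Nil[OF r] by simp
        next
          case 2
          then show ?thesis using less.hyps[of u "take q v" r] r by simp
        next
          case 3
          then show ?thesis using less.hyps[of "take p u" v r] r by simp
        next
          case 4
          then show ?thesis using shp_x[OF r, of "drop p u" "drop q v"] by simp
        qed
      qed
      have "shp (tmul (Z s r) (x r)) u v = (\<Sum>p\<le>length u. \<Sum>q\<le>length v.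
          (if p = length u then Z s r u * (Z s r (take q v) * x r (drop q v)) else 0)
          + (if q = length v then Z s r (take p u) * x r (drop p u) * Z s r v else 0))"
        unfolding shp_tmul by (intro sum.cong refl S) auto
      also have "\<dots> = (\<Sum>p\<le>length u. \<Sum>q\<le>length v. (if p = length u then Z s r u * (Z s r (take q v) * x r (drop q v)) else 0))
          + (\<Sum>p\<le>length u. \<Sum>q\<le>length v. (if q = length v then Z s r (take p u) * x r (drop p u) * Z s r v else 0))"
        by (simp add: sum.distrib)
      also have "(\<Sum>p\<le>length u. \<Sum>q\<le>length v. (if p = length u then Z s r u * (Z s r (take q v) * x r (drop q v)) else 0))
          = Z s r u * tmul (Z s r) (x r) v"
        by (subst sum.swap) (simp add: tmul_def sum_distrib_left)
      also have "(\<Sum>p\<le>length u. \<Sum>q\<le>length v. (if q = length v then Z s r (take p u) * x r (drop p u) * Z s r v else 0))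
          = tmul (Z s r) (x r) u * Z s r v"
        by (simp add: tmul_def sum_distrib_right)
      finally show ?thesis .
    qed
    ultimately show ?thesis by simp
  qed
  then have "shp (Z s t) u v - Z s t u * Z s t v = shp (Z s s) u v - Z s s u * Z s s v"
    by (rule zero_deriv_unique) (use s less.prems in auto)
  also have "\<dots> = 0"
  proof (cases "u = [] \<or> v = []")
    case True
    then show ?thesis by (auto simp: Z_refl tunit_def)
  next
    case False
    have "shp tunit u v = 0" by (rule shp_eq_0) (use False in \<open>auto simp: tunit_def\<close>)
    then show ?thesis using False by (simp add: Z_refl tunit_def)
  qed
  finally show ?case by simp
qed

text \<open>\<^const>\<open>MinExt\<close> is normalised to vanish off the square.\<close>

definition Z0 :: "real \<Rightarrow> real \<Rightarrow> tensor" where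
  "Z0 s t = (if s \<in> {0..T} \<and> t \<in> {0..T} then Z s t else (\<lambda>w. 0))"

lemma sgrm_Z0: "sgrm T d Z0"
  unfolding sgrm_def
proof (intro conjI ballI allI impI)
  show "\<exists>s\<in>{0..T}. \<exists>t\<in>{0..T}. Z0 s t \<noteq> (\<lambda>w. 0)"
    using T by (intro bexI[of _ 0]) (auto simp: Z0_def Z_refl tunit_def fun_eq_iff)
  show "smooth_on {0..T} (\<lambda>t. Z0 s t w)" if "s \<in> {0..T}" for s w
    by (rule smooth_on_cong[OF T Z_smooth[of s w]]) (use that in \<open>simp add: Z0_def\<close>)
qed (auto simp: Z0_def Z_alphabet Z_chen Z_shuffle pair_sh_eq_shp)

lemma diag_Z0:
  assumes s: "s \<in> {0..T}"
  shows "diag T Z0 s = x s"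
proof
  fix w
  have "((\<lambda>t. Z0 s t w) has_vector_derivative x s w) (at s within {0..T})"
    by (rule has_vector_derivative_transform[OF s, of _ "\<lambda>t. Z s t w"])
      (use Z_flow[OF s, of s w] s in \<open>auto simp: Z0_def Z_refl\<close>)
  then show "diag T Z0 s w = x s w"
    unfolding diag_def using vector_derivative_within_closed_interval[OF T s] by blast
qed

end

text \<open>Coefficients up to \<open>N\<close> are shared; above \<open>N\<close> one derivative
  vanishes by \<open>in_LN\<close>, the other because \<open>W\<close> does.\<close>

lemma minext_diag:
  assumes T: "0 < T" and W: "nsgrm T d N W" and X: "minext_of T d N W X" and s: "s \<in> {0..T}"
  shows "diag T X s = diag T W s"
proof
  interpret W: tensor_path T d "\<lambda>n. n \<le> N" W by (rule nsgrm_tensor_path[OF T W])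
  interpret X: tensor_path T d "\<lambda>n. True" X
    using sgrm_tensor_path[OF T] X by (simp add: minext_of_def)
  fix w
  show "diag T X s w = diag T W s w"
  proof (cases "length w \<le> N")
    case True
    show ?thesis
      by (rule X.diag_eqI[OF s], rule has_vector_derivative_transform[OF s _ W.diag_has_vector_derivative[OF s]])
        (use X True s in \<open>auto simp: minext_of_def\<close>)
  next
    case False
    obtain l where "diag T X s = proj N l" using X s unfolding minext_of_def in_LN_def by blast
    then have "diag T X s w = 0" using False by (simp add: proj_def)
    then show ?thesis using W.diag_level[OF s, of w] False by simp
  qed
qed

text \<open>By \<open>minext_diag\<close> every candidate solves one equation, driven by the
  derivative of \<open>W\<close>, from the unit; this yields uniqueness and dictates the control for
  existence.\<close>

lemma minext_exists_unique:
  assumes T: "0 < T" and d: "d \<ge> 1" and W: "nsgrm T d N W"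
  shows "\<exists>!X. minext_of T d N W X \<and> (\<forall>s t. \<not> (s \<in> {0..T} \<and> t \<in> {0..T}) \<longrightarrow> X s t = (\<lambda>w. 0))"
proof -
  interpret W: tensor_path T d "\<lambda>n. n \<le> N" W by (rule nsgrm_tensor_path[OF T W])
  interpret control T d "diag T W"
    by unfold_locales (use T W.diag_primitive W.diag_alphabet W.smooth_diag in auto)
  have ext: "minext_of T d N W Z0"
    unfolding minext_of_def
  proof (intro conjI sgrm_Z0 ballI allI impI)
    show "Z0 s t w = W s t w" if st: "s \<in> {0..T}" "t \<in> {0..T}" and w: "length w \<le> N" for s t w
    proof -
      have "Z s t w = W s t w"
        by (rule ode_unique[where B = "\<lambda>n. n \<le> N" and x = "diag T W" and T = T and s = s])
          (use st w W.diag_Nil Z_flow W.flow W.at_refl in \<open>auto simp: Z_refl\<close>)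
      then show ?thesis using st by (simp add: Z0_def)
    qed
    show "in_LN d N (diag T Z0 s)" if s: "s \<in> {0..T}" for s
      unfolding in_LN_def
    proof (intro exI conjI)
      show "lie d (diag T W s)"
        by (rule primitive_imp_lie[OF d W.diag_primitive[OF s], of N])
          (use W.diag_alphabet[OF s] W.diag_level[OF s] in \<open>auto simp: words_def\<close>)
      show "diag T Z0 s = proj N (diag T W s)"
        using W.diag_level[OF s] by (auto simp: diag_Z0[OF s] proj_def fun_eq_iff)
    qed
  qed
  show ?thesis
  proof (rule ex1I[of _ Z0])
    show "minext_of T d N W Z0 \<and> (\<forall>s t. \<not> (s \<in> {0..T} \<and> t \<in> {0..T}) \<longrightarrow> Z0 s t = (\<lambda>w. 0))"
      using ext by (auto simp: Z0_def)
  next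
    fix X assume X: "minext_of T d N W X \<and> (\<forall>s t. \<not> (s \<in> {0..T} \<and> t \<in> {0..T}) \<longrightarrow> X s t = (\<lambda>w. 0))"
    interpret X: tensor_path T d "\<lambda>n. True" X
      using sgrm_tensor_path[OF T] X by (simp add: minext_of_def)
    have "X s t w = Z0 s t w" for s t w
    proof (cases "s \<in> {0..T} \<and> t \<in> {0..T}")
      case True
      then have st: "s \<in> {0..T}" "t \<in> {0..T}" by auto
      have dX: "diag T X r = diag T W r" if "r \<in> {0..T}" for r using minext_diag[OF T W] X that by blast
      have "X s t w = Z s t w"
        by (rule ode_unique[where B = "\<lambda>n. True" and x = "diag T W" and T = T and s = s])
          (use st W.diag_Nil Z_flow X.flow[OF st(1)] X.at_refl in \<open>auto simp: Z_refl dX\<close>)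
      then show ?thesis using st by (simp add: Z0_def)
    next
      case False
      then have "X s t = (\<lambda>w. 0)" "Z0 s t = (\<lambda>w. 0)" using X unfolding Z0_def by presburger+
      then show ?thesis by simp
    qed
    then show "X = Z0" by blast
  qed
qed

lemma minext_of_MinExt:
  assumes "0 < T" "d \<ge> 1" "nsgrm T d N W"
  shows "minext_of T d N W (MinExt T d N W)"
  using theI'[OF minext_exists_unique[OF assms]] unfolding MinExt_def by blast

section \<open>Smooth vector fields\<close>

text \<open>Derivatives are taken along one fixed direction \<open>k\<close> at a time, so the
  recursion never passes to functions with values in linear maps.\<close>

primrec Cn :: "nat \<Rightarrow> ('a::euclidean_space \<Rightarrow> 'b::real_normed_vector) \<Rightarrow> bool" where
  "Cn 0 h \<longleftrightarrow> True"
| "Cn (Suc n) h \<longleftrightarrow> (\<exists>D. (\<forall>y. (h has_derivative D y) (at y)) \<and> (\<forall>k. Cn n (\<lambda>y. D y k)))"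

lemma Cn_Suc_imp: "Cn (Suc n) h \<Longrightarrow> Cn n h"
  by (induction n arbitrary: h) auto

lemma Cn_const: "Cn n (\<lambda>y. c)"
proof (induction n arbitrary: c)
  case (Suc n)
  then show ?case by (auto intro!: exI[of _ "\<lambda>y k. 0"])
qed simp

lemma Cn_id: "Cn n (\<lambda>y. y)"
  by (cases n) (auto intro!: exI[of _ "\<lambda>y k. k"] Cn_const)

lemma Cn_add: "Cn n f \<Longrightarrow> Cn n g \<Longrightarrow> Cn n (\<lambda>y. f y + g y)"
proof (induction n arbitrary: f g)
  case (Suc n)
  then obtain D E where
    "\<forall>y. (f has_derivative D y) (at y)" "\<forall>k. Cn n (\<lambda>y. D y k)"
    "\<forall>y. (g has_derivative E y) (at y)" "\<forall>k. Cn n (\<lambda>y. E y k)" by auto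
  then show ?case using Suc.IH
    by (auto intro!: exI[of _ "\<lambda>y k. D y k + E y k"] has_derivative_add)
qed simp

lemma Cn_sum: "(\<And>i. i \<in> I \<Longrightarrow> Cn n (f i)) \<Longrightarrow> Cn n (\<lambda>y. \<Sum>i\<in>I. f i y)"
  by (induction I rule: infinite_finite_induct) (simp_all add: Cn_const Cn_add)

lemma Cn_bounded_linear:
  assumes "bounded_linear L"
  shows "Cn n f \<Longrightarrow> Cn n (\<lambda>y. L (f y))"
proof (induction n arbitrary: f)
  case (Suc n)
  then obtain D where D: "\<forall>y. (f has_derivative D y) (at y)" "\<forall>k. Cn n (\<lambda>y. D y k)" by auto
  then show ?case using Suc.IH
    by (auto intro!: exI[of _ "\<lambda>y k. L (D y k)"] bounded_linear.has_derivative[OF assms])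
qed simp

lemma Cn_scaleR: "Cn n f \<Longrightarrow> Cn n g \<Longrightarrow> Cn n (\<lambda>y. f y *\<^sub>R g y)"
proof (induction n arbitrary: f g)
  case (Suc n)
  then obtain D E where
    D: "\<forall>y. (f has_derivative D y) (at y)" "\<forall>k. Cn n (\<lambda>y. D y k)" and
    E: "\<forall>y. (g has_derivative E y) (at y)" "\<forall>k. Cn n (\<lambda>y. E y k)" by auto
  have "Cn n f" "Cn n g" using Suc.prems Cn_Suc_imp by blast+
  then have "\<forall>k. Cn n (\<lambda>y. f y *\<^sub>R E y k + D y k *\<^sub>R g y)"
    using Suc.IH D E by (intro allI Cn_add) auto
  moreover have "\<forall>y. ((\<lambda>y. f y *\<^sub>R g y) has_derivative (\<lambda>k. f y *\<^sub>R E y k + D y k *\<^sub>R g y)) (at y)"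
    using D E by (auto intro!: has_derivative_scaleR)
  ultimately show ?case by auto
qed simp

definition Cinf :: "('a::euclidean_space \<Rightarrow> 'b::real_normed_vector) \<Rightarrow> bool" where
  "Cinf h \<longleftrightarrow> (\<forall>n. Cn n h)"

lemma Cinf_id: "Cinf (\<lambda>y. y)"
  and Cinf_sum: "(\<And>i. i \<in> I \<Longrightarrow> Cinf (h i)) \<Longrightarrow> Cinf (\<lambda>y. \<Sum>i\<in>I. h i y)"
  and Cinf_scaleR: "Cinf a \<Longrightarrow> Cinf g \<Longrightarrow> Cinf (\<lambda>y. a y *\<^sub>R g y)"
  and Cinf_scaleR_const: "Cinf g \<Longrightarrow> Cinf (\<lambda>y. c *\<^sub>R g y)"
  and Cinf_inner: "Cinf k \<Longrightarrow> Cinf (\<lambda>y. k y \<bullet> b)"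
  by (simp_all add: Cinf_def Cn_id Cn_add Cn_sum Cn_scaleR Cn_const
      Cn_bounded_linear[OF bounded_linear_inner_left])

lemma frechet_eqI: "(h has_derivative D) (at y) \<Longrightarrow> frechet_derivative h (at y) = D"
  by (rule frechet_derivative_at[symmetric])

lemma Cinf_has_derivative:
  assumes "Cinf h"
  shows "(h has_derivative frechet_derivative h (at y)) (at y)"
proof -
  have "Cn (Suc 0) h" using assms Cinf_def by blast
  then obtain D where "(h has_derivative D) (at y)" by auto
  then show ?thesis using frechet_eqI by metis
qed

lemma Cinf_frechet:
  assumes "Cinf h"
  shows "Cinf (\<lambda>y. frechet_derivative h (at y) k)"
  unfolding Cinf_def
proof
  fix n
  have "Cn (Suc n) h" using assms Cinf_def by blast
  then obtain D where D: "\<And>y. (h has_derivative D y) (at y)" "\<And>k. Cn n (\<lambda>y. D y k)" by auto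
  show "Cn n (\<lambda>y. frechet_derivative h (at y) k)"
    unfolding frechet_eqI[OF D(1)] by (rule D(2))
qed

lemma Cinf_linear: "Cinf h \<Longrightarrow> linear (frechet_derivative h (at y))"
  using Cinf_has_derivative has_derivative_linear by blast

lemma Cinf_continuous: "Cinf h \<Longrightarrow> isCont h y"
  using Cinf_has_derivative has_derivative_continuous by blast

text \<open>Closure of \<open>Cinf\<close> under differentiation is for fixed directions; the basis
  expansion moves a varying direction into scalar factors, which makes \<open>tri\<close>
  smooth.\<close>

lemma frechet_euclidean:
  assumes "Cinf h"
  shows "frechet_derivative h (at y) k = (\<Sum>b\<in>Basis. (k \<bullet> b) *\<^sub>R frechet_derivative h (at y) b)"
proof -
  interpret linear "frechet_derivative h (at y)" by (rule Cinf_linear[OF assms])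
  have "frechet_derivative h (at y) k = frechet_derivative h (at y) (\<Sum>b\<in>Basis. (k \<bullet> b) *\<^sub>R b)"
    by (simp only: euclidean_representation)
  then show ?thesis by (simp only: sum scale)
qed

lemma Cinf_tri:
  assumes "Cinf g" "Cinf h"
  shows "Cinf (tri g h)"
proof -
  have "tri g h = (\<lambda>y. \<Sum>b\<in>Basis. (g y \<bullet> b) *\<^sub>R frechet_derivative h (at y) b)"
    unfolding tri_def by (rule ext) (rule frechet_euclidean[OF assms(2)])
  then show ?thesis
    by (simp add: Cinf_sum Cinf_scaleR Cinf_inner Cinf_frechet assms)
qed

text \<open>Two mean value steps: along \<open>k\<close> for the difference of \<open>f\<close> over
  the shift by \<open>l\<close>, then along \<open>l\<close>. The left side is symmetric in
  \<open>k\<close> and \<open>l\<close>.\<close>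

lemma second_difference:
  fixes f :: "'a::euclidean_space \<Rightarrow> real"
  assumes f: "Cinf f" and s: "0 < s"
  shows "\<exists>\<xi>\<in>{0<..<s}. \<exists>\<eta>\<in>{0<..<s}. f (y + s *\<^sub>R k + s *\<^sub>R l) - f (y + s *\<^sub>R k) - f (y + s *\<^sub>R l) + f y
    = s\<^sup>2 * frechet_derivative (\<lambda>y. frechet_derivative f (at y) k) (at (y + \<xi> *\<^sub>R k + \<eta> *\<^sub>R l)) l"
proof -
  define D where "D y = frechet_derivative f (at y) k" for y
  have D: "Cinf D" unfolding D_def by (rule Cinf_frechet[OF f])
  have along: "((\<lambda>t. h (p + t *\<^sub>R m)) has_derivative (\<lambda>r. r * frechet_derivative h (at (p + t *\<^sub>R m)) m))
      (at t within S)" if h: "Cinf h" for h :: "'a \<Rightarrow> real" and p m t S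
  proof -
    have "((\<lambda>t. h (p + t *\<^sub>R m)) has_derivative (\<lambda>r. frechet_derivative h (at (p + t *\<^sub>R m)) (r *\<^sub>R m))) (at t within S)"
      by (rule has_derivative_compose[OF _ Cinf_has_derivative[OF h], of "\<lambda>t. p + t *\<^sub>R m"])
        (auto intro!: derivative_eq_intros)
    then show ?thesis using linear_cmul[OF Cinf_linear[OF h]] by (simp add: mult.commute)
  qed
  have "\<exists>\<xi>\<in>{0<..<s}. (f (y + s *\<^sub>R l + s *\<^sub>R k) - f (y + s *\<^sub>R k)) - (f (y + s *\<^sub>R l + 0 *\<^sub>R k) - f (y + 0 *\<^sub>R k))
      = (s - 0) * D (y + s *\<^sub>R l + \<xi> *\<^sub>R k) - (s - 0) * D (y + \<xi> *\<^sub>R k)"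
    unfolding D_def
    by (rule mvt_simple[OF s, of "\<lambda>t. f (y + s *\<^sub>R l + t *\<^sub>R k) - f (y + t *\<^sub>R k)"])
      (intro has_derivative_diff along f)
  then obtain \<xi> where \<xi>: "\<xi> \<in> {0<..<s}"
    "f (y + s *\<^sub>R k + s *\<^sub>R l) - f (y + s *\<^sub>R k) - f (y + s *\<^sub>R l) + f y
      = s * (D (y + \<xi> *\<^sub>R k + s *\<^sub>R l) - D (y + \<xi> *\<^sub>R k))"
    by (auto simp: algebra_simps)
  have "\<exists>\<eta>\<in>{0<..<s}. D (y + \<xi> *\<^sub>R k + s *\<^sub>R l) - D (y + \<xi> *\<^sub>R k + 0 *\<^sub>R l)
      = (s - 0) * frechet_derivative D (at (y + \<xi> *\<^sub>R k + \<eta> *\<^sub>R l)) l"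
    by (rule mvt_simple[OF s, of "\<lambda>t. D (y + \<xi> *\<^sub>R k + t *\<^sub>R l)"]) (intro along D)
  then obtain \<eta> where \<eta>: "\<eta> \<in> {0<..<s}"
    "D (y + \<xi> *\<^sub>R k + s *\<^sub>R l) - D (y + \<xi> *\<^sub>R k) = s * frechet_derivative D (at (y + \<xi> *\<^sub>R k + \<eta> *\<^sub>R l)) l"
    by auto
  show ?thesis
    by (rule bexI[OF _ \<xi>(1)], rule bexI[OF _ \<eta>(1)])
      (use \<xi>(2)[unfolded \<eta>(2)] in \<open>simp add: D_def[abs_def] power2_eq_square\<close>)
qed

text \<open>Both mixed derivatives, sampled at suitable points near \<open>y\<close>, equal the same
  second difference divided by \<open>s\<^sup>2\<close>; by continuity they cannot differ at
  \<open>y\<close>.\<close>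

lemma second_derivative_symmetric_real:
  fixes f :: "'a::euclidean_space \<Rightarrow> real"
  assumes f: "Cinf f"
  shows "frechet_derivative (\<lambda>y. frechet_derivative f (at y) k) (at y) l
    = frechet_derivative (\<lambda>y. frechet_derivative f (at y) l) (at y) k"
proof (rule ccontr)
  define a where "a = (\<lambda>y. frechet_derivative (\<lambda>y. frechet_derivative f (at y) k) (at y) l)"
  define b where "b = (\<lambda>y. frechet_derivative (\<lambda>y. frechet_derivative f (at y) l) (at y) k)"
  assume "\<not> ?thesis"
  then have e: "0 < dist (a y) (b y) / 2" by (simp add: a_def b_def)
  have "isCont a y" "isCont b y"
    unfolding a_def b_def by (intro Cinf_continuous Cinf_frechet f)+
  then have "\<exists>d>0. \<forall>z. dist z y < d \<longrightarrow> dist (a z) (a y) < dist (a y) (b y) / 2"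
    "\<exists>d>0. \<forall>z. dist z y < d \<longrightarrow> dist (b z) (b y) < dist (a y) (b y) / 2"
    using e by (simp_all only: continuous_at_eps_delta)
  then obtain d1 d2 where d1: "0 < d1" "\<And>z. dist z y < d1 \<Longrightarrow> dist (a z) (a y) < dist (a y) (b y) / 2"
    and d2: "0 < d2" "\<And>z. dist z y < d2 \<Longrightarrow> dist (b z) (b y) < dist (a y) (b y) / 2"
    by blast
  \<comment> \<open>This keeps the sample points within \<open>min d1 d2\<close> of
    \<open>y\<close>; the summand 1 makes the bound strict and avoids a zero denominator.\<close>
  define s where "s = min d1 d2 / (norm k + norm l + 1)"
  have n: "0 < norm k + norm l + 1" by (simp add: add_nonneg_pos)
  have s: "0 < s" using d1(1) d2(1) n by (simp add: s_def)
  have near: "dist (y + \<xi> *\<^sub>R k + \<eta> *\<^sub>R l) y < min d1 d2" if "\<xi> \<in> {0<..<s}" "\<eta> \<in> {0<..<s}" for \<xi> \<eta>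
  proof -
    have "dist (y + \<xi> *\<^sub>R k + \<eta> *\<^sub>R l) y = norm (\<xi> *\<^sub>R k + \<eta> *\<^sub>R l)" by (simp add: dist_norm add.assoc)
    also have "\<dots> \<le> \<xi> * norm k + \<eta> * norm l"
      using norm_triangle_ineq[of "\<xi> *\<^sub>R k" "\<eta> *\<^sub>R l"] that by simp
    also have "\<dots> \<le> s * norm k + s * norm l"
      using that by (intro add_mono mult_right_mono) auto
    also have "\<dots> < s * (norm k + norm l + 1)" using s by (simp add: algebra_simps)
    also have "\<dots> = min d1 d2" using n by (simp add: s_def)
    finally show ?thesis .
  qed
  obtain \<xi> \<eta> where 1: "\<xi> \<in> {0<..<s}" "\<eta> \<in> {0<..<s}"
    "f (y + s *\<^sub>R k + s *\<^sub>R l) - f (y + s *\<^sub>R k) - f (y + s *\<^sub>R l) + f y = s\<^sup>2 * a (y + \<xi> *\<^sub>R k + \<eta> *\<^sub>R l)"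
    using second_difference[OF f s, of y k l] unfolding a_def by blast
  obtain \<eta>' \<xi>' where 2: "\<xi>' \<in> {0<..<s}" "\<eta>' \<in> {0<..<s}"
    "f (y + s *\<^sub>R l + s *\<^sub>R k) - f (y + s *\<^sub>R l) - f (y + s *\<^sub>R k) + f y = s\<^sup>2 * b (y + \<eta>' *\<^sub>R l + \<xi>' *\<^sub>R k)"
    using second_difference[OF f s, of y l k] unfolding b_def by blast
  have sw: "y + \<eta>' *\<^sub>R l + \<xi>' *\<^sub>R k = y + \<xi>' *\<^sub>R k + \<eta>' *\<^sub>R l" "y + s *\<^sub>R l + s *\<^sub>R k = y + s *\<^sub>R k + s *\<^sub>R l"
    by (simp_all add: algebra_simps)
  have "s\<^sup>2 * a (y + \<xi> *\<^sub>R k + \<eta> *\<^sub>R l) = s\<^sup>2 * b (y + \<xi>' *\<^sub>R k + \<eta>' *\<^sub>R l)"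
    using 1(3) 2(3) unfolding sw by linarith
  then have eq: "a (y + \<xi> *\<^sub>R k + \<eta> *\<^sub>R l) = b (y + \<xi>' *\<^sub>R k + \<eta>' *\<^sub>R l)" using s by simp
  have "dist (a y) (b y) \<le> dist (a (y + \<xi> *\<^sub>R k + \<eta> *\<^sub>R l)) (a y) + dist (b (y + \<xi>' *\<^sub>R k + \<eta>' *\<^sub>R l)) (b y)"
    unfolding eq by (rule dist_triangle3)
  then show False
    using d1(2)[of "y + \<xi> *\<^sub>R k + \<eta> *\<^sub>R l"] d2(2)[of "y + \<xi>' *\<^sub>R k + \<eta>' *\<^sub>R l"] near[OF 1(1,2)] near[OF 2(1,2)]
    by auto
qed

lemma second_derivative_symmetric:
  fixes h :: "'a::euclidean_space \<Rightarrow> 'b::euclidean_space"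
  assumes h: "Cinf h"
  shows "frechet_derivative (\<lambda>y. frechet_derivative h (at y) k) (at y) l
    = frechet_derivative (\<lambda>y. frechet_derivative h (at y) l) (at y) k"
proof (rule euclidean_eqI)
  fix b :: 'b
  have c: "frechet_derivative (\<lambda>y. g y \<bullet> b) (at y) = (\<lambda>k. frechet_derivative g (at y) k \<bullet> b)"
    if "Cinf g" for g :: "'a \<Rightarrow> 'b" and y
    by (rule frechet_eqI)
      (rule bounded_linear.has_derivative[OF bounded_linear_inner_left Cinf_has_derivative[OF that]])
  show "frechet_derivative (\<lambda>y. frechet_derivative h (at y) k) (at y) l \<bullet> b
      = frechet_derivative (\<lambda>y. frechet_derivative h (at y) l) (at y) k \<bullet> b"
    using second_derivative_symmetric_real[OF Cinf_inner[OF h, of b], of k y l]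
    by (simp add: c[OF h] c[OF Cinf_frechet[OF h]])
qed

section \<open>The product of vector fields and its commutator\<close>

lemma tri_add_left:
  "Cinf h \<Longrightarrow> tri (\<lambda>y. f y + g y) h = (\<lambda>y. tri f h y + tri g h y)"
  and tri_scaleR_left: "Cinf h \<Longrightarrow> tri (\<lambda>y. c *\<^sub>R f y) h = (\<lambda>y. c *\<^sub>R tri f h y)"
  by (simp_all add: tri_def linear_add[OF Cinf_linear] linear_cmul[OF Cinf_linear])

lemma tri_add_right:
  assumes "Cinf g" "Cinf h"
  shows "tri f (\<lambda>y. g y + h y) = (\<lambda>y. tri f g y + tri f h y)"
  unfolding tri_def
  by (rule ext, subst frechet_eqI[OF has_derivative_add[OF assms[THEN Cinf_has_derivative]]]) simp

lemma tri_scaleR_right: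
  assumes "Cinf g"
  shows "tri f (\<lambda>y. c *\<^sub>R g y) = (\<lambda>y. c *\<^sub>R tri f g y)"
  unfolding tri_def
  by (rule ext, subst frechet_eqI[OF has_derivative_scaleR_right[OF Cinf_has_derivative[OF assms]]]) simp

lemma tri_zero_right: "tri f (\<lambda>y. 0) = (\<lambda>y. 0)"
  by (simp add: tri_def)

text \<open>The Leibniz rule separates a first-order part, the derivative of \<open>h\<close> along
  \<open>tri f g\<close>, from the second derivative of \<open>h\<close> in the directions
  \<open>g y\<close> and \<open>f y\<close>.\<close>

lemma tri_tri:
  assumes g: "Cinf g" and h: "Cinf h"
  shows "tri f (tri g h) y
    = frechet_derivative h (at y) (tri f g y)
      + (\<Sum>b\<in>Basis. (g y \<bullet> b) *\<^sub>R frechet_derivative (\<lambda>y. frechet_derivative h (at y) b) (at y) (f y))"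
proof -
  have "tri g h = (\<lambda>y. \<Sum>b\<in>Basis. (g y \<bullet> b) *\<^sub>R frechet_derivative h (at y) b)"
    unfolding tri_def by (rule ext) (rule frechet_euclidean[OF h])
  moreover have "((\<lambda>y. \<Sum>b\<in>Basis. (g y \<bullet> b) *\<^sub>R frechet_derivative h (at y) b) has_derivative
      (\<lambda>k. \<Sum>b\<in>Basis. (g y \<bullet> b) *\<^sub>R frechet_derivative (\<lambda>y. frechet_derivative h (at y) b) (at y) k
        + (frechet_derivative g (at y) k \<bullet> b) *\<^sub>R frechet_derivative h (at y) b)) (at y)"
    by (intro has_derivative_sum has_derivative_scaleR Cinf_has_derivative Cinf_frechet h
        bounded_linear.has_derivative[OF bounded_linear_inner_left] g)
  ultimately have "frechet_derivative (tri g h) (at y) =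
      (\<lambda>k. \<Sum>b\<in>Basis. (g y \<bullet> b) *\<^sub>R frechet_derivative (\<lambda>y. frechet_derivative h (at y) b) (at y) k
        + (frechet_derivative g (at y) k \<bullet> b) *\<^sub>R frechet_derivative h (at y) b)"
    by (simp only: frechet_eqI)
  then show ?thesis
    unfolding tri_def[of f] frechet_euclidean[OF h, of y "frechet_derivative g (at y) (f y)"]
    by (simp only: sum.distrib add.commute)
qed

text \<open>The second-order parts are the second derivative of \<open>h\<close> along
  \<open>f y\<close> and \<open>g y\<close> in the two orders, and cancel. This is the pre-Lie
  identity for \<open>tri\<close>.\<close>

lemma tri_commutator:
  fixes h :: "'a::euclidean_space \<Rightarrow> 'a"
  assumes f: "Cinf f" and g: "Cinf g" and h: "Cinf h"
  shows "tri f (tri g h) y - tri g (tri f h) y = tri (\<lambda>y. tri f g y - tri g f y) h y"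
proof -
  let ?D = "\<lambda>k. frechet_derivative (\<lambda>y. frechet_derivative h (at y) k) (at y)"
  have "(\<Sum>b\<in>Basis. (g y \<bullet> b) *\<^sub>R ?D b (f y)) = (\<Sum>b\<in>Basis. (g y \<bullet> b) *\<^sub>R ?D (f y) b)"
    by (simp only: second_derivative_symmetric[OF h, of _ y "f y"])
  also have "\<dots> = ?D (f y) (g y)"
    by (rule frechet_euclidean[OF Cinf_frechet[OF h], symmetric])
  also have "\<dots> = ?D (g y) (f y)" by (rule second_derivative_symmetric[OF h])
  also have "\<dots> = (\<Sum>b\<in>Basis. (f y \<bullet> b) *\<^sub>R ?D (g y) b)"
    by (rule frechet_euclidean[OF Cinf_frechet[OF h]])
  also have "\<dots> = (\<Sum>b\<in>Basis. (f y \<bullet> b) *\<^sub>R ?D b (g y))"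
    by (simp only: second_derivative_symmetric[OF h, of _ y "g y"])
  finally show ?thesis
    unfolding tri_tri[OF g h] tri_tri[OF f h]
    by (simp add: tri_def[of "\<lambda>y. tri f g y - tri g f y"] linear_diff[OF Cinf_linear[OF h]])
qed

lemma vf_smooth_bdd_Cinf:
  assumes "vf_smooth_bdd f"
  shows "Cinf f"
proof -
  obtain P :: "'a list \<Rightarrow> 'a \<Rightarrow> 'a" where P: "P [] = f"
    "\<And>bs y. set bs \<subseteq> Basis \<Longrightarrow>
        (P bs has_derivative (\<lambda>h. \<Sum>b\<in>Basis. (h \<bullet> b) *\<^sub>R P (b # bs) y)) (at y)"
    using assms unfolding vf_smooth_bdd_def by auto
  have "Cn n (P bs)" if "set bs \<subseteq> Basis" for n bs
    using that
  proof (induction n arbitrary: bs)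
    case (Suc n)
    have "Cn n (\<lambda>y. \<Sum>b\<in>Basis. (k \<bullet> b) *\<^sub>R P (b # bs) y)" for k
      by (intro Cn_sum Cn_scaleR Cn_const Suc.IH) (use Suc.prems in auto)
    then show ?case
      unfolding Cn.simps
      by (intro exI[of _ "\<lambda>y k. \<Sum>b\<in>Basis. (k \<bullet> b) *\<^sub>R P (b # bs) y"] conjI allI P(2)[OF Suc.prems])
  qed simp
  then show ?thesis unfolding Cinf_def using P(1) by (metis empty_subsetI list.set(1))
qed

section \<open>Evaluation of tensor polynomials\<close>

definition ev :: "tensor \<Rightarrow> (word \<Rightarrow> 'v::real_vector) \<Rightarrow> 'v" where
  "ev x \<phi> = (\<Sum>w\<in>{w. x w \<noteq> 0}. x w *\<^sub>R \<phi> w)"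

lemma ev_superset:
  assumes "finite A" "\<And>w. x w \<noteq> 0 \<Longrightarrow> w \<in> A"
  shows "ev x \<phi> = (\<Sum>w\<in>A. x w *\<^sub>R \<phi> w)"
  unfolding ev_def by (rule sum.mono_neutral_left) (use assms in auto)

lemma ev_letter: "ev (letter i) \<phi> = \<phi> [i]"
  by (subst ev_superset[of "{[i]}"]) (auto simp: letter_def split: if_splits)

lemma ev_tunit: "ev tunit \<phi> = \<phi> []"
  by (subst ev_superset[of "{[]}"]) (auto simp: tunit_def split: if_splits)

lemma ev_add:
  assumes "finite {w. a w \<noteq> 0}" "finite {w. b w \<noteq> 0}"
  shows "ev (\<lambda>w. a w + b w) \<phi> = ev a \<phi> + ev b \<phi>"
proof -
  let ?A = "{w. a w \<noteq> 0} \<union> {w. b w \<noteq> 0}"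
  have "finite ?A" using assms by simp
  then show ?thesis
    by (subst (1 2 3) ev_superset[of ?A]) (auto simp: sum.distrib scaleR_add_left)
qed

lemma ev_scale:
  assumes "finite {w. a w \<noteq> 0}"
  shows "ev (\<lambda>w. c * a w) \<phi> = c *\<^sub>R ev a \<phi>"
  by (subst (1 2) ev_superset[OF assms]) (auto simp: scaleR_sum_right)

lemma ev_diff:
  assumes "finite {w. a w \<noteq> 0}" "finite {w. b w \<noteq> 0}"
  shows "ev (\<lambda>w. a w - b w) \<phi> = ev a \<phi> - ev b \<phi>"
  using ev_add[of a "\<lambda>w. - 1 * b w" \<phi>] ev_scale[of b "- 1" \<phi>] assms by simp

text \<open>The cut positions of \<open>w\<close> are the pairs \<open>(p, q)\<close> with
  \<open>p @ q = w\<close>; grouping the pairs from the two supports by their concatenation gives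
  the double sum.\<close>

lemma ev_tmul:
  assumes A: "finite {w. a w \<noteq> 0}" and B: "finite {w. b w \<noteq> 0}"
  shows "ev (tmul a b) \<phi> = (\<Sum>p\<in>{w. a w \<noteq> 0}. \<Sum>q\<in>{w. b w \<noteq> 0}. (a p * b q) *\<^sub>R \<phi> (p @ q))"
proof -
  let ?S = "{w. a w \<noteq> 0} \<times> {w. b w \<noteq> 0}" and ?c = "\<lambda>(p, q). p @ q"
  have t: "tmul a b w = (\<Sum>(p, q)\<in>{z \<in> ?S. ?c z = w}. a p * b q)" for w
  proof -
    have "bij_betw (\<lambda>i. (take i w, drop i w)) {..length w} {z. ?c z = w}"
      by (rule bij_betwI[of _ _ _ "\<lambda>z. length (fst z)"]) auto
    then have "tmul a b w = (\<Sum>(p, q)\<in>{z. ?c z = w}. a p * b q)"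
      unfolding tmul_def by (simp add: sum.reindex_bij_betw[symmetric])
    moreover have "finite {z. ?c z = w}"
      using \<open>bij_betw _ _ _\<close> bij_betw_finite by blast
    ultimately show ?thesis
      by (simp, intro sum.mono_neutral_right) auto
  qed
  have fin: "finite ?S" using A B by simp
  have "ev (tmul a b) \<phi> = (\<Sum>w\<in>?c ` ?S. tmul a b w *\<^sub>R \<phi> w)"
  proof (rule ev_superset)
    show "finite (?c ` ?S)" using fin by simp
    fix w assume "tmul a b w \<noteq> 0"
    then show "w \<in> ?c ` ?S" by (rule tmul_neq_0) force
  qed
  also have "\<dots> = (\<Sum>w\<in>?c ` ?S. \<Sum>z\<in>{z \<in> ?S. ?c z = w}. (a (fst z) * b (snd z)) *\<^sub>R \<phi> (fst z @ snd z))"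
    unfolding t scaleR_sum_left by (intro sum.cong) (auto simp: case_prod_unfold)
  also have "\<dots> = (\<Sum>z\<in>?S. (a (fst z) * b (snd z)) *\<^sub>R \<phi> (fst z @ snd z))"
    by (rule sum.image_gen[OF fin, symmetric])
  finally show ?thesis by (simp add: sum.cartesian_product case_prod_unfold)
qed

definition tpoly :: "nat \<Rightarrow> tensor \<Rightarrow> bool" where
  "tpoly d x \<longleftrightarrow> finite {w. x w \<noteq> 0} \<and> (\<forall>w. x w \<noteq> 0 \<longrightarrow> set w \<subseteq> {1..d})"

lemma tpoly_finite: "tpoly d x \<Longrightarrow> finite {w. x w \<noteq> 0}"
  by (simp add: tpoly_def)

lemma tpoly_tmul:
  assumes "tpoly d a" "tpoly d b"
  shows "tpoly d (tmul a b)"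
proof -
  have "{w. tmul a b w \<noteq> 0} \<subseteq> (\<lambda>(p, q). p @ q) ` ({w. a w \<noteq> 0} \<times> {w. b w \<noteq> 0})"
    by (auto elim!: tmul_neq_0)
  moreover have "set w \<subseteq> {1..d}" if "tmul a b w \<noteq> 0" for w
    using tmul_neq_0[OF that] assms unfolding tpoly_def by (metis set_append Un_least)
  ultimately show ?thesis
    using assms unfolding tpoly_def by (meson finite_SigmaI finite_imageI finite_subset)
qed

lemma tpoly_add: "tpoly d a \<Longrightarrow> tpoly d b \<Longrightarrow> tpoly d (\<lambda>w. a w + b w)"
proof -
  assume ab: "tpoly d a" "tpoly d b"
  have "{w. a w + b w \<noteq> 0} \<subseteq> {w. a w \<noteq> 0} \<union> {w. b w \<noteq> 0}" by auto
  then show ?thesis using ab finite_subset unfolding tpoly_def by blast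
qed

lemma tpoly_scale: "tpoly d a \<Longrightarrow> tpoly d (\<lambda>w. c * a w)"
  unfolding tpoly_def by (auto intro: finite_subset[of _ "{w. a w \<noteq> 0}"])

lemma lie_tpoly: "lie d x \<Longrightarrow> tpoly d x \<and> x [] = 0"
proof (induction rule: lie.induct)
  case (lie_letter i)
  then show ?case
    by (auto simp: tpoly_def letter_def intro: finite_subset[of _ "{[i]}"] split: if_splits)
next
  case (lie_bracket a b)
  then have "tpoly d (\<lambda>w. tmul a b w + - 1 * tmul b a w)"
    by (intro tpoly_add tpoly_scale tpoly_tmul) auto
  then show ?case using lie_bracket by (simp add: bracket_def)
qed (auto intro: tpoly_add tpoly_scale)

section \<open>Differential operators of words and of polynomials\<close>

definition Lop :: "(nat \<Rightarrow> 'a::euclidean_space \<Rightarrow> 'a) \<Rightarrow> word \<Rightarrow> ('a \<Rightarrow> 'a) \<Rightarrow> 'a \<Rightarrow> 'a" where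
  "Lop F w h = foldr (\<lambda>i. tri (F i)) w h"

lemma Lop_Nil [simp]: "Lop F [] h = h"
  and Lop_Cons [simp]: "Lop F (i # w) h = tri (F i) (Lop F w h)"
  and Lop_append: "Lop F (p @ q) h = Lop F p (Lop F q h)"
  by (simp_all add: Lop_def)

text \<open>The one-letter clause of \<open>vf_word\<close> fits in because the derivative of the
  identity is the identity. A general \<open>h\<close> in \<open>Lop\<close> is what makes operators
  composable.\<close>

lemma vf_word_Lop: "vf_word F w = Lop F w (\<lambda>y. y)"
  by (induction F w rule: vf_word.induct) (auto simp: tri_def)

definition Lx :: "(nat \<Rightarrow> 'a::euclidean_space \<Rightarrow> 'a) \<Rightarrow> tensor \<Rightarrow> ('a \<Rightarrow> 'a) \<Rightarrow> 'a \<Rightarrow> 'a" where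
  "Lx F x h = (\<lambda>y. ev x (\<lambda>w. Lop F w h y))"

lemma vf_tensor_Lx: "vf_tensor F x = Lx F x (\<lambda>y. y)"
  by (simp add: vf_tensor_def Lx_def ev_def vf_word_Lop)

lemma Cinf_Lop:
  "\<forall>i\<in>{1..d}. Cinf (F i) \<Longrightarrow> set w \<subseteq> {1..d} \<Longrightarrow> Cinf h \<Longrightarrow> Cinf (Lop F w h)"
  by (induction w) (auto intro!: Cinf_tri)

text \<open>\<open>frechet_derivative\<close> is known to be additive only for differentiable
  summands, hence the smoothness assumption.\<close>

lemma Lop_sum:
  assumes F: "\<forall>i\<in>{1..d}. Cinf (F i)" and w: "set w \<subseteq> {1..d}"
    and A: "finite A" and h: "\<And>a. a \<in> A \<Longrightarrow> Cinf (h a)"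
  shows "Lop F w (\<lambda>y. \<Sum>a\<in>A. c a *\<^sub>R h a y) = (\<lambda>y. \<Sum>a\<in>A. c a *\<^sub>R Lop F w (h a) y)"
  using w
proof (induction w)
  case (Cons i w)
  have "tri (F i) (\<lambda>y. \<Sum>a\<in>A. c a *\<^sub>R k a y) = (\<lambda>y. \<Sum>a\<in>A. c a *\<^sub>R tri (F i) (k a) y)"
    if "\<And>a. a \<in> A \<Longrightarrow> Cinf (k a)" for k
    using A that
  proof (induction A rule: finite_induct)
    case (insert a A)
    then show ?case
      by (simp add: tri_add_right tri_scaleR_right Cinf_scaleR_const Cinf_sum)
  qed (simp add: tri_zero_right)
  from this[of "\<lambda>a. Lop F w (h a)"] show ?case
    using Cons Cinf_Lop[OF F _ h] by simp
qed simp

context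
  fixes d :: nat and F :: "nat \<Rightarrow> 'a::euclidean_space \<Rightarrow> 'a"
  assumes F: "\<forall>i\<in>{1..d}. Cinf (F i)"
begin

lemma Cinf_Lx: "tpoly d x \<Longrightarrow> Cinf h \<Longrightarrow> Cinf (Lx F x h)"
  unfolding Lx_def ev_def tpoly_def
  by (intro Cinf_sum Cinf_scaleR_const Cinf_Lop[OF F]) auto

lemma Lx_tmul:
  assumes a: "tpoly d a" and b: "tpoly d b" and h: "Cinf h"
  shows "Lx F (tmul a b) h = Lx F a (Lx F b h)"
proof
  fix y
  have "Lop F p (Lx F b h) y = (\<Sum>q\<in>{w. b w \<noteq> 0}. b q *\<^sub>R Lop F p (Lop F q h) y)"
    if "a p \<noteq> 0" for p
  proof -
    have "set p \<subseteq> {1..d}" "finite {w. b w \<noteq> 0}" using a b that by (auto simp: tpoly_def)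
    moreover have "Cinf (Lop F q h)" if "q \<in> {w. b w \<noteq> 0}" for q
      using b that by (intro Cinf_Lop[OF F] h) (auto simp: tpoly_def)
    ultimately show ?thesis
      unfolding Lx_def ev_def by (subst Lop_sum[OF F]) auto
  qed
  then show "Lx F (tmul a b) h y = Lx F a (Lx F b h) y"
    unfolding Lx_def[of F "tmul a b"] Lx_def[of F a] ev_tmul[OF tpoly_finite[OF a] tpoly_finite[OF b]]
    by (simp add: ev_def Lop_append scaleR_sum_right)
qed

lemma Lx_bracket:
  assumes a: "tpoly d a" and b: "tpoly d b" and h: "Cinf h"
  shows "Lx F (bracket a b) h = (\<lambda>y. Lx F a (Lx F b h) y - Lx F b (Lx F a h) y)"
  unfolding Lx_tmul[OF a b h, symmetric] Lx_tmul[OF b a h, symmetric]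
  unfolding Lx_def bracket_def
  by (intro ext ev_diff tpoly_finite[where d = d] tpoly_tmul a b)

text \<open>Only for Lie elements is the differential operator a derivation, that is, a vector field;
  the second-order terms cancel in brackets.\<close>

lemma tri_vf_tensor_lie:
  assumes "lie d x" "Cinf h"
  shows "tri (vf_tensor F x) h = Lx F x h"
  using assms
proof (induction arbitrary: h rule: lie.induct)
  case (lie_letter i)
  have "vf_tensor F (letter i) = F i"
    by (simp add: vf_tensor_def ev_def[symmetric] ev_letter)
  then show ?case by (simp add: Lx_def ev_letter)
next
  case (lie_add a b)
  have f: "finite {w. a w \<noteq> 0}" "finite {w. b w \<noteq> 0}" using lie_add.hyps[THEN lie_tpoly] by (simp_all add: tpoly_def)
  have "Lx F (\<lambda>w. a w + b w) k = (\<lambda>y. Lx F a k y + Lx F b k y)" for k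
    unfolding Lx_def by (simp only: ev_add[OF f])
  then show ?case
    unfolding vf_tensor_Lx by (simp only: tri_add_left[OF lie_add.prems] lie_add.IH[OF lie_add.prems, unfolded vf_tensor_Lx])
next
  case (lie_scale a c)
  have f: "finite {w. a w \<noteq> 0}" using lie_scale.hyps[THEN lie_tpoly] by (simp add: tpoly_def)
  have "Lx F (\<lambda>w. c * a w) k = (\<lambda>y. c *\<^sub>R Lx F a k y)" for k
    unfolding Lx_def by (simp only: ev_scale[OF f])
  then show ?case
    unfolding vf_tensor_Lx by (simp only: tri_scaleR_left[OF lie_scale.prems] lie_scale.IH[OF lie_scale.prems, unfolded vf_tensor_Lx])
next
  case (lie_bracket a b)
  have p: "tpoly d a" "tpoly d b" using lie_bracket.hyps[THEN lie_tpoly] by simp_all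
  have c: "Cinf (vf_tensor F a)" "Cinf (vf_tensor F b)"
    unfolding vf_tensor_Lx by (intro Cinf_Lx p Cinf_id)+
  \<comment> \<open>The hypotheses are applied with the fields of \<open>a\<close> and
    \<open>b\<close> in place of \<open>h\<close> as well as with \<open>h\<close> itself; hence the
    generalisation over \<open>h\<close>.\<close>
  note L = lie_bracket.IH[symmetric]
  have "vf_tensor F (bracket a b)
      = (\<lambda>y. tri (vf_tensor F a) (vf_tensor F b) y - tri (vf_tensor F b) (vf_tensor F a) y)"
    unfolding vf_tensor_Lx[of F "bracket a b"] Lx_bracket[OF p Cinf_id]
    unfolding vf_tensor_Lx[symmetric] by (simp only: L(1)[OF c(2)] L(2)[OF c(1)])
  moreover have "Lx F (bracket a b) h
      = (\<lambda>y. tri (vf_tensor F a) (tri (vf_tensor F b) h) y - tri (vf_tensor F b) (tri (vf_tensor F a) h) y)"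
    unfolding Lx_bracket[OF p lie_bracket.prems]
    by (simp add: L lie_bracket.prems Cinf_tri c)
  ultimately show ?case
    by (simp only: tri_commutator[OF c lie_bracket.prems])
qed

end

section \<open>Translations\<close>

text \<open>The image of the single word \<open>w\<close> under \<open>T_v\<close>.\<close>

definition Pw :: "(nat \<Rightarrow> tensor) \<Rightarrow> word \<Rightarrow> tensor" where
  "Pw v w = tprod_list (map (\<lambda>i z. letter i z + v i z) w)"

lemma Pw_Nil [simp]: "Pw v [] = tunit"
  and Pw_Cons: "Pw v (i # w) = tmul (\<lambda>z. letter i z + v i z) (Pw v w)"
  by (simp_all add: Pw_def)

lemma Pw_append: "Pw v (p @ q) = tmul (Pw v p) (Pw v q)"
  by (induction p) (simp_all add: Pw_Cons tmul_assoc)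

lemma tv_Pw: "tv d v x u = (\<Sum>w\<in>words d (length u). x w * Pw v w u)"
  by (simp add: tv_def Pw_def)

context
  fixes d :: nat and v :: "nat \<Rightarrow> tensor"
  assumes v: "\<forall>i\<in>{1..d}. lie d (v i)"
begin

lemma lie_letter_v: "i \<in> {1..d} \<Longrightarrow> lie d (\<lambda>z. letter i z + v i z)"
  using v by (intro lie_add lie_letter) auto

lemma tpoly_Pw: "set w \<subseteq> {1..d} \<Longrightarrow> tpoly d (Pw v w)"
proof (induction w)
  case Nil
  then show ?case by (auto simp: tpoly_def tunit_def)
next
  case (Cons i w)
  then show ?case unfolding Pw_Cons using lie_tpoly[OF lie_letter_v[of i]] by (intro tpoly_tmul) auto
qed

text \<open>Every factor has no constant term and only words of length at most \<open>M\<close>,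
  where \<open>1 \<le> M\<close> accounts for the letter itself. The lower bound justifies the
  cut-off in \<open>tv\<close>, the upper one yields the level \<open>N * N'\<close>.\<close>

lemma Pw_length:
  assumes M: "1 \<le> M" "\<forall>i\<in>{1..d}. \<forall>u. v i u \<noteq> 0 \<longrightarrow> length u \<le> M"
    and "set w \<subseteq> {1..d}" "Pw v w u \<noteq> 0"
  shows "length w \<le> length u \<and> length u \<le> length w * M"
  using assms(3,4)
proof (induction w arbitrary: u)
  case Nil
  then show ?case by (simp add: tunit_def split: if_splits)
next
  case (Cons i w)
  have i: "i \<in> {1..d}" using Cons.prems by simp
  from Cons.prems(2) obtain p q where pq: "u = p @ q" "letter i p + v i p \<noteq> 0" "Pw v w q \<noteq> 0"
    unfolding Pw_Cons by (rule tmul_neq_0)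
  have "p \<noteq> []" using pq(2) lie_tpoly[OF lie_letter_v[OF i]] by auto
  moreover have "length p \<le> M"
    using pq(2) M(1) M(2)[rule_format, OF i, of p] by (cases "p = [i]") (auto simp: letter_def)
  ultimately show ?case using Cons.IH[OF _ pq(3)] Cons.prems(1) pq(1)
    by (cases p) auto
qed

text \<open>The minimum is over a non-empty set: finitely many Lie polynomials have finite supports,
  so their word lengths have a common bound, and truncating there changes none of them.\<close>

lemma Nprime_bound:
  "1 \<le> Nprime d v \<and> (\<forall>i\<in>{1..d}. \<forall>u. v i u \<noteq> 0 \<longrightarrow> length u \<le> Nprime d v)"
proof -
  let ?P = "\<lambda>n. 1 \<le> n \<and> (\<forall>i\<in>{1..d}. in_LN d n (v i))"
  have "finite (\<Union>i\<in>{1..d}. {u. v i u \<noteq> 0})"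
    by (rule finite_UN_I) (use v lie_tpoly tpoly_finite in \<open>blast+\<close>)
  then have "finite (length ` (\<Union>i\<in>{1..d}. {u. v i u \<noteq> 0}))" by simp
  then obtain M where M: "\<forall>i\<in>{1..d}. \<forall>u. v i u \<noteq> 0 \<longrightarrow> length u \<le> M"
    unfolding finite_nat_set_iff_bounded_le by blast
  have "v i = proj (max 1 M) (v i)" if "i \<in> {1..d}" for i
    using M[rule_format, OF that] by (auto simp: proj_def fun_eq_iff) (meson max.coboundedI2)
  then have "?P (max 1 M)" unfolding in_LN_def using v by (meson max.cobounded1)
  then have P: "?P (Nprime d v)" unfolding Nprime_def by (rule LeastI)
  show ?thesis
  proof (intro conjI ballI allI impI)
    show "1 \<le> Nprime d v" using P by blast
    fix i u assume i: "i \<in> {1..d}" and u: "v i u \<noteq> 0"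
    obtain l where "v i = proj (Nprime d v) l" using P i unfolding in_LN_def by blast
    then show "length u \<le> Nprime d v" using u by (auto simp: proj_def split: if_splits)
  qed
qed

lemma Pw_length_le: "set w \<subseteq> {1..d} \<Longrightarrow> Pw v w u \<noteq> 0 \<Longrightarrow> length w \<le> length u"
  using Pw_length[of "Nprime d v"] Nprime_bound by blast

text \<open>Words longer than \<open>u\<close> contribute nothing at \<open>u\<close>, by the lower
  length bound, so the range of summation in \<open>tv\<close> can be exchanged for one independent
  of \<open>u\<close>.\<close>

lemma tv_superset:
  assumes A: "finite A" "\<And>w. x w \<noteq> 0 \<Longrightarrow> w \<in> A" "\<And>w. w \<in> A \<Longrightarrow> set w \<subseteq> {1..d}"
  shows "tv d v x u = (\<Sum>w\<in>A. x w * Pw v w u)"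
proof -
  have "tv d v x u = (\<Sum>w\<in>A \<inter> words d (length u). x w * Pw v w u)"
    unfolding tv_Pw using A by (intro sum.mono_neutral_right) auto
  also have "\<dots> = (\<Sum>w\<in>A. x w * Pw v w u)"
  proof (rule sum.mono_neutral_left)
    show "\<forall>w\<in>A - A \<inter> words d (length u). x w * Pw v w u = 0"
      using A(3) Pw_length_le[of _ u] by (auto simp: words_def)
  qed (use A in auto)
  finally show ?thesis .
qed

lemma tv_ev:
  assumes "tpoly d x"
  shows "tv d v x u = ev x (\<lambda>w. Pw v w u)"
  unfolding ev_def using tv_superset[of "{w. x w \<noteq> 0}" x] assms by (auto simp: tpoly_def)

lemma tv_tmul:
  assumes a: "tpoly d a" and b: "tpoly d b"
  shows "tv d v (tmul a b) = tmul (tv d v a) (tv d v b)"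
proof
  fix u
  have "tmul (tv d v a) (tv d v b) u = (\<Sum>i\<le>length u. \<Sum>p\<in>{w. a w \<noteq> 0}. \<Sum>q\<in>{w. b w \<noteq> 0}.
      (a p * b q) * (Pw v p (take i u) * Pw v q (drop i u)))"
    unfolding tmul_def tv_ev[OF a] tv_ev[OF b] ev_def
    by (simp only: sum_product real_scaleR_def mult_ac)
  also have "\<dots> = (\<Sum>p\<in>{w. a w \<noteq> 0}. \<Sum>q\<in>{w. b w \<noteq> 0}. (a p * b q) * tmul (Pw v p) (Pw v q) u)"
    unfolding tmul_def sum_distrib_left
    by (subst sum.swap, rule sum.cong[OF refl], subst sum.swap, rule refl)
  also have "\<dots> = tv d v (tmul a b) u"
    unfolding tv_ev[OF tpoly_tmul[OF a b]] ev_tmul[OF tpoly_finite[OF a] tpoly_finite[OF b]]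
    by (simp add: Pw_append)
  finally show "tv d v (tmul a b) u = tmul (tv d v a) (tv d v b) u" by simp
qed

text \<open>\<open>T_v\<close> preserves brackets and sends letters to Lie elements. This supplies
  the membership in \<open>in_LN\<close> that \<open>solves_good\<close> demands of the translated
  path.\<close>

lemma lie_tv: "lie d x \<Longrightarrow> lie d (tv d v x)"
proof (induction rule: lie.induct)
  case (lie_letter i)
  have "tpoly d (letter i)" using lie_tpoly lie.lie_letter[OF lie_letter] by blast
  then have "tv d v (letter i) = (\<lambda>z. letter i z + v i z)"
    by (intro ext) (simp add: tv_ev ev_letter Pw_Cons)
  then show ?case using lie_letter_v[OF lie_letter] by simp
next
  case (lie_add a b)
  have "tv d v (\<lambda>w. a w + b w) = (\<lambda>u. tv d v a u + tv d v b u)"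
    by (simp add: tv_Pw[abs_def] sum.distrib distrib_right)
  then show ?case using lie.lie_add[OF lie_add.IH] by simp
next
  case (lie_scale a c)
  have "tv d v (\<lambda>w. c * a w) = (\<lambda>u. c * tv d v a u)"
    by (simp add: tv_Pw[abs_def] sum_distrib_left mult.assoc)
  then show ?case using lie.lie_scale[OF lie_scale.IH] by simp
next
  case (lie_bracket a b)
  have p: "tpoly d a" "tpoly d b" using lie_bracket lie_tpoly by blast+
  have "tv d v (\<lambda>w. tmul a b w - tmul b a w) = (\<lambda>u. tv d v (tmul a b) u - tv d v (tmul b a) u)"
    by (simp add: tv_Pw[abs_def] sum_subtractf left_diff_distrib)
  then have "tv d v (bracket a b) = bracket (tv d v a) (tv d v b)"
    by (simp add: bracket_def tv_tmul p)
  then show ?case using lie.lie_bracket[OF lie_bracket.IH] by simp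
qed

lemma tv_length:
  assumes M: "1 \<le> M" "\<forall>i\<in>{1..d}. \<forall>u. v i u \<noteq> 0 \<longrightarrow> length u \<le> M"
    and x: "\<And>w. w \<notin> words d K \<Longrightarrow> x w = 0" and u: "tv d v x u \<noteq> 0"
  shows "u \<in> words d (K * M)"
proof -
  have "tv d v x u = (\<Sum>w\<in>words d K. x w * Pw v w u)"
    by (rule tv_superset[OF finite_words]) (use x in \<open>auto simp: words_def\<close>)
  then have "(\<Sum>w\<in>words d K. x w * Pw v w u) \<noteq> 0" using u by simp
  then obtain w where w: "w \<in> words d K" "x w * Pw v w u \<noteq> 0"
    by (rule sum.not_neutral_contains_not_neutral)
  then have sw: "set w \<subseteq> {1..d}" and lw: "length w \<le> K" and P: "Pw v w u \<noteq> 0"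
    by (auto simp: words_def)
  have "length u \<le> length w * M" using Pw_length[OF M sw P] by simp
  also have "\<dots> \<le> K * M" using lw by simp
  finally show ?thesis using tpoly_Pw[OF sw] P by (simp add: words_def tpoly_def)
qed

text \<open>The word is consumed from the left, so each step multiplies by \<open>e_i + v_i\<close>
  alone. That factor is Lie, hence its field acts as its operator, although \<open>Pw v w\<close> is
  in general not Lie.\<close>

lemma vf_word_Fv:
  assumes F: "\<forall>i\<in>{1..d}. Cinf (F i)" and w: "set w \<subseteq> {1..d}"
  shows "vf_word (Fv F v) w = vf_tensor F (Pw v w)"
proof -
  have "Lop (Fv F v) w (\<lambda>y. y) = Lx F (Pw v w) (\<lambda>y. y)"
    using w
  proof (induction w)
    case Nil
    then show ?case by (simp add: Lx_def ev_tunit)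
  next
    case (Cons i w)
    then have i: "i \<in> {1..d}" and w: "set w \<subseteq> {1..d}" by auto
    let ?l = "\<lambda>z. letter i z + v i z"
    have l: "lie d ?l" by (rule lie_letter_v[OF i])
    have fin: "finite {w. letter i w \<noteq> 0}" "finite {w. v i w \<noteq> 0}"
      using lie_tpoly tpoly_finite lie.lie_letter[OF i] v i by blast+
    have "Fv F v i = vf_tensor F ?l"
      unfolding Fv_def vf_tensor_Lx Lx_def
      by (simp add: ev_add[OF fin] ev_letter) (simp add: tri_def)
    then have "Lop (Fv F v) (i # w) (\<lambda>y. y) = tri (vf_tensor F ?l) (Lx F (Pw v w) (\<lambda>y. y))"
      using Cons.IH[OF w] by simp
    also have "\<dots> = Lx F ?l (Lx F (Pw v w) (\<lambda>y. y))"
      by (intro tri_vf_tensor_lie[OF F l] Cinf_Lx[OF F] tpoly_Pw w Cinf_id)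
    also have "\<dots> = Lx F (tmul ?l (Pw v w)) (\<lambda>y. y)"
      by (rule Lx_tmul[OF F conjunct1[OF lie_tpoly[OF l]] tpoly_Pw[OF w] Cinf_id, symmetric])
    finally show ?case by (simp add: Pw_Cons)
  qed
  then show ?thesis by (simp add: vf_word_Lop vf_tensor_Lx)
qed

text \<open>Translating the tensor is dual to translating the fields: two finite sums are exchanged,
  and \<open>K * M\<close> bounds the length of every word in \<open>Pw v w\<close>.\<close>

lemma translated_field:
  assumes F: "\<forall>i\<in>{1..d}. Cinf (F i)"
    and M: "1 \<le> M" "\<forall>i\<in>{1..d}. \<forall>u. v i u \<noteq> 0 \<longrightarrow> length u \<le> M"
    and x: "\<And>w. w \<notin> words d K \<Longrightarrow> x w = 0"
  shows "(\<Sum>u\<in>words d (K * M). tv d v x u *\<^sub>R vf_word F u y) = (\<Sum>w\<in>words d K. x w *\<^sub>R vf_word (Fv F v) w y)"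
proof -
  have "(\<Sum>u\<in>words d (K * M). tv d v x u *\<^sub>R vf_word F u y)
      = (\<Sum>u\<in>words d (K * M). \<Sum>w\<in>words d K. (x w * Pw v w u) *\<^sub>R vf_word F u y)"
    unfolding scaleR_sum_left[symmetric]
    by (subst tv_superset[OF finite_words[of d K]]) (use x in \<open>auto simp: words_def\<close>)
  also have "\<dots> = (\<Sum>w\<in>words d K. x w *\<^sub>R (\<Sum>u\<in>words d (K * M). Pw v w u *\<^sub>R vf_word F u y))"
    by (subst sum.swap) (simp add: scaleR_sum_right)
  also have "\<dots> = (\<Sum>w\<in>words d K. x w *\<^sub>R vf_word (Fv F v) w y)"
  proof (intro sum.cong refl)
    fix w assume "w \<in> words d K"
    then have w: "set w \<subseteq> {1..d}" "length w \<le> K" by (auto simp: words_def)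
    have "length w * M \<le> K * M" using w(2) by simp
    then have "ev (Pw v w) (\<lambda>u. vf_word F u y) = (\<Sum>u\<in>words d (K * M). Pw v w u *\<^sub>R vf_word F u y)"
      using le_trans[OF conjunct2[OF Pw_length[OF M w(1)]]] tpoly_Pw[OF w(1)]
      by (intro ev_superset finite_words) (simp add: words_def tpoly_def)
    then show "x w *\<^sub>R (\<Sum>u\<in>words d (K * M). Pw v w u *\<^sub>R vf_word F u y) = x w *\<^sub>R vf_word (Fv F v) w y"
      by (simp add: vf_word_Fv[OF F w(1)] vf_tensor_def ev_def)
  qed
  finally show ?thesis .
qed

end

section \<open>Diagonal derivatives after translation, and the equivalence of the equations\<close>

lemma tv_has_vector_derivative:
  assumes "\<And>w. ((\<lambda>t. x t w) has_vector_derivative x' w) G"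
  shows "((\<lambda>t. tv d v (x t) u) has_vector_derivative tv d v x' u) G"
  unfolding tv_def by (intro has_vector_derivative_sum has_vector_derivative_mult_left assms)

text \<open>Each coefficient of \<open>tv\<close> is a fixed finite linear combination of
  coefficients, so it commutes with the derivative.\<close>

lemma (in tensor_path) diag_Tv_path:
  assumes "s \<in> {0..T}"
  shows "diag T (Tv_path d v X) s = tv d v (diag T X s)"
proof
  fix u
  show "diag T (Tv_path d v X) s u = tv d v (diag T X s) u"
    unfolding Tv_path_def diag_def[of T "\<lambda>s t. tv d v (X s t)"]
    by (rule vector_derivative_within_closed_interval[OF T assms tv_has_vector_derivative])
      (rule diag_has_vector_derivative[OF assms])
qed

lemma diag_proj:
  assumes "0 < T" "s \<in> {0..T}" "length w \<le> M"
  shows "diag T (\<lambda>s t. proj M (Y s t)) s w = diag T Y s w"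
  using assms by (simp add: diag_def proj_def)

theorem theorem2p26:
  fixes T :: real and d N :: nat
    and F :: "nat \<Rightarrow> 'a::euclidean_space \<Rightarrow> 'a"
    and v :: "nat \<Rightarrow> tensor"
    and X W :: "real \<Rightarrow> real \<Rightarrow> tensor"
    and Y :: "real \<Rightarrow> 'a"
  assumes "T > 0" and "d \<ge> 1"
    and "\<forall>i\<in>{1..d}. vf_smooth_bdd (F i)"
    and "good_sgrm T d X"
    and "nsgrm T d N W"
    and "\<forall>i\<in>{1..d}. lie d (v i)"
  shows "(solves_good T d F (Tv_path d v X) Y \<longleftrightarrow> solves_good T d (Fv F v) X Y)
       \<and> (solves T d F (N * Nprime d v) (calT T d N v W) Y \<longleftrightarrow> solves T d (Fv F v) N W Y)"
proof
  note T = assms(1) and d = assms(2) and W = assms(5) and v = assms(6)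
  have F: "\<forall>i\<in>{1..d}. Cinf (F i)" using assms(3) vf_smooth_bdd_Cinf by blast
  let ?M = "Nprime d v"
  have M: "1 \<le> ?M" "\<forall>i\<in>{1..d}. \<forall>u. v i u \<noteq> 0 \<longrightarrow> length u \<le> ?M"
    using Nprime_bound[OF v] by blast+
  note field = translated_field[OF v F M]
  show "solves_good T d F (Tv_path d v X) Y \<longleftrightarrow> solves_good T d (Fv F v) X Y"
  proof -
    obtain K0 Y0 where X: "nsgrm T d K0 Y0" "minext_of T d K0 Y0 X"
      using assms(4) unfolding good_sgrm_def by blast
    interpret X: tensor_path T d "\<lambda>n. True" X
      using sgrm_tensor_path[OF T] X by (simp add: minext_of_def)
    have supp: "diag T X s w = 0"
      if K: "in_LN d K (diag T X s)" and s: "s \<in> {0..T}" and w: "w \<notin> words d K" for K s w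
    proof (cases "set w \<subseteq> {1..d}")
      case True
      then have "\<not> length w \<le> K" using w by (simp add: words_def)
      moreover obtain l where "diag T X s = proj K l" using K unfolding in_LN_def by blast
      ultimately show ?thesis by (simp add: proj_def)
    next
      case False
      then show ?thesis using X.diag_alphabet s by blast
    qed
    show ?thesis
    proof
      assume "solves_good T d F (Tv_path d v X) Y"
      then obtain K where K': "\<forall>s\<in>{0..T}. in_LN d K (diag T (Tv_path d v X) s)"
        and Y': "solves T d F K (Tv_path d v X) Y"
        unfolding solves_good_def by blast
      have K: "in_LN d K (tv d v (diag T X s))" if "s \<in> {0..T}" for s
        using K' that X.diag_Tv_path[OF that] by metis
      have Y: "smooth_on {0..T} Y" using Y' unfolding solves_def by blast
      have dY: "(Y has_vector_derivative (\<Sum>w\<in>words d K. tv d v (diag T X s) w *\<^sub>R vf_word F w (Y s)))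
          (at s within {0..T})" if "s \<in> {0..T}" for s
        using Y' that unfolding solves_def X.diag_Tv_path[OF that, symmetric] by blast
      \<comment> \<open>The given \<open>K\<close> restricts the translated derivative only; a level
        for \<open>X\<close> itself comes from its being a good sgrm.\<close>
      have K0: "in_LN d K0 (diag T X s)" if "s \<in> {0..T}" for s
        using X(2) that unfolding minext_of_def by blast
      have "(\<Sum>w\<in>words d K. tv d v (diag T X s) w *\<^sub>R vf_word F w y)
          = (\<Sum>w\<in>words d K0. diag T X s w *\<^sub>R vf_word (Fv F v) w y)" if s: "s \<in> {0..T}" for s y
      proof -
        let ?x = "tv d v (diag T X s)"
        have u: "u \<in> words d (K0 * ?M)" if "?x u \<noteq> 0" for u
          by (rule tv_length[OF v M _ that]) (use supp[OF K0[OF s] s] in auto)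
        obtain l where l: "?x = proj K l" using K[OF s] unfolding in_LN_def by blast
        have "u \<in> words d K" if "?x u \<noteq> 0" for u
        proof -
          have "length u \<le> K" using that l by (auto simp: proj_def split: if_splits)
          then show ?thesis using u[OF that] by (simp add: words_def)
        qed
        \<comment> \<open>The support of \<open>?x\<close> lies in both \<open>words d K\<close> and
          \<open>words d (K0 * ?M)\<close>, so the two sums agree whichever level is larger.\<close>
        then have "ev ?x (\<lambda>w. vf_word F w y) = (\<Sum>w\<in>words d K. ?x w *\<^sub>R vf_word F w y)"
          by (intro ev_superset) auto
        moreover have "ev ?x (\<lambda>w. vf_word F w y) = (\<Sum>w\<in>words d (K0 * ?M). ?x w *\<^sub>R vf_word F w y)"
          using u by (intro ev_superset) auto
        ultimately show ?thesis using field[of K0 "diag T X s" y] supp[OF K0[OF s] s] by simp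
      qed
      then have "solves T d (Fv F v) K0 X Y" unfolding solves_def using Y dY by simp
      then show "solves_good T d (Fv F v) X Y" unfolding solves_good_def using K0 by blast
    next
      assume "solves_good T d (Fv F v) X Y"
      then obtain K where K: "\<And>s. s \<in> {0..T} \<Longrightarrow> in_LN d K (diag T X s)"
        and Y: "solves T d (Fv F v) K X Y" unfolding solves_good_def by blast
      have "solves T d F (K * ?M) (Tv_path d v X) Y"
        using Y field[of K "diag T X _"] supp[OF K] unfolding solves_def
        by (simp add: X.diag_Tv_path del: atLeastAtMost_iff)
      moreover have "in_LN d (K * ?M) (diag T (Tv_path d v X) s)" if s: "s \<in> {0..T}" for s
        unfolding in_LN_def X.diag_Tv_path[OF s]
      proof (intro exI conjI)
        \<comment> \<open>\<open>in_LN\<close> only says that the derivative is a truncated Lie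
          element; that it is itself Lie follows from primitivity and its bounded support.\<close>
        have "lie d (diag T X s)"
          by (rule primitive_imp_lie[OF d X.diag_primitive[OF s], of K]) (rule supp[OF K[OF s] s])
        then show "lie d (tv d v (diag T X s))" by (rule lie_tv[OF v])
        have "length u \<le> K * ?M" if "tv d v (diag T X s) u \<noteq> 0" for u
          using tv_length[OF v M _ that, of K] supp[OF K[OF s] s] by (auto simp: words_def)
        then show "tv d v (diag T X s) = proj (K * ?M) (tv d v (diag T X s))"
          by (auto simp: proj_def fun_eq_iff)
      qed
      ultimately show "solves_good T d F (Tv_path d v X) Y" unfolding solves_good_def by blast
    qed
  qed
  show "solves T d F (N * ?M) (calT T d N v W) Y \<longleftrightarrow> solves T d (Fv F v) N W Y"
  proof -
    interpret W: tensor_path T d "\<lambda>n. n \<le> N" W by (rule nsgrm_tensor_path[OF T W])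
    have ext: "minext_of T d N W (MinExt T d N W)" by (rule minext_of_MinExt[OF T d W])
    interpret E: tensor_path T d "\<lambda>n. True" "MinExt T d N W"
      using sgrm_tensor_path[OF T] ext by (simp add: minext_of_def)
    have calT: "calT T d N v W = (\<lambda>s t. proj (N * ?M) (Tv_path d v (MinExt T d N W) s t))"
      by (simp add: calT_def Tv_path_def)
    \<comment> \<open>Truncation at \<open>N * ?M\<close> leaves the summed coefficients alone, and
      \<open>minext_diag\<close> replaces the derivative of the extension by that of
      \<open>W\<close>.\<close>
    have calc: "diag T (calT T d N v W) s w = tv d v (diag T W s) w" if "s \<in> {0..T}" "w \<in> words d (N * ?M)" for s w
      using that diag_proj[OF T that(1), of w "N * ?M"] E.diag_Tv_path[OF that(1)] minext_diag[OF T W ext that(1)]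
      by (simp add: calT words_def)
    have "(\<Sum>w\<in>words d (N * ?M). diag T (calT T d N v W) s w *\<^sub>R vf_word F w y)
        = (\<Sum>w\<in>words d N. diag T W s w *\<^sub>R vf_word (Fv F v) w y)" if s: "s \<in> {0..T}" for s y
    proof -
      have "diag T W s w = 0" if "w \<notin> words d N" for w
        using that W.diag_alphabet[OF s, of w] W.diag_level[OF s, of w] by (auto simp: words_def)
      then show ?thesis using field[of N "diag T W s" y] calc[OF s] by simp
    qed
    then show ?thesis unfolding solves_def by simp
  qed
qed

end
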